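(* Let $I$ be an infinite set, let $\mathcal{U}$ be a free ultrafilter on $I$, and let $(\mathcal{M}_i)_{i\in I}$ be a family of factorial $W^*$-bundles over compact Hausdorff spaces $K_i$. Then $$Z\Big(\prod\nolimits^{\mathcal{U}}\mathcal{M}_i\Big)=\prod\nolimits^{\mathcal{U}}Z(\mathcal{M}_i).$$
   Context: $Z(A)$ denotes the center of a $C^*$-algebra $A$, and $T(A)$ the set of its tracial states with the weak$^*$ topology. A $W^*$-bundle over a compact Hausdorff space $K$ is a unital $C^*$-algebra $\mathcal{M}$ with a unital embedding of $C(K)$ in the center of $\mathcal{M}$ and a faithful unital conditional expectation $E\colon\mathcal{M}\to C(K)$ such that (1) $E(ab)=E(ba)$ for all $a,b\in\mathcal{M}$, and (2) the $C^*$-norm unit ball of $\mathcal{M}$ is complete with respect to the norm $\|a\|_{2,K}=\|E(a^*a)\|^{1/2}$. For a regular Borel probability measure $\mu\in\mathrm{Prob}(K)$, set $\tau_\mu(a)=\int_K E(a)\,d\mu$. The $W^*$-bundle $\mathcal{M}$ is factorial if $\{\tau_\mu:\mu\in\mathrm{Prob}(K)\}$ is a closed face of $T(\mathcal{M})$. The tracial ultraproduct is $$\prod\nolimits^{\mathcal{U}}\mathcal{M}_i=\Big(\prod_{i\in I}\mathcal{M}_i\Big)\Big/\Big\{(a_i)_{i\in I}:\lim_{i\to\mathcal{U}}\|a_i\|_{2,K_i}=0\Big\},$$ where $\prod_{i\in I}\mathcal{M}_i$ is the $C^*$-algebra of norm-bounded families. $\prod^{\mathcal{U}}Z(\mathcal{M}_i)$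 is defined in the same way using the restrictions of the norms $\|\cdot\|_{2,K_i}$ to $Z(\mathcal{M}_i)$, and is identified with the subalgebra of $\prod^{\mathcal{U}}\mathcal{M}_i$ consisting of the elements admitting a representing family $(a_i)_{i\in I}$ with $a_i\in Z(\mathcal{M}_i)$ for all $i\in I$. *)

theory Defs
  imports
    "HOL-Analysis.Analysis"
    "HOL-Probability.Probability_Measure"
    "HOL-Algebra.QuotRing"
    "HOL-Algebra.Module"
begin

section \<open>Unital C*-algebras\<close>

text \<open>
  C*-algebras are carrier-based structures extending those of HOL-Algebra, so that a family of
  C*-algebras indexed by a set is a function into a record type. Families whose members live on
  different types can be moved to a common one (a sum type), so a single element type is no
  restriction.
\<close>

definition complex_ring :: "complex ring" where
  "complex_ring = \<lparr>carrier = UNIV, mult = (*), one = 1, zero = 0, add = (+)\<rparr>"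

record 'a cstar_algebra = "(complex, 'a) module" +
  adj :: "'a \<Rightarrow> 'a"
  cnorm :: "'a \<Rightarrow> real"

text \<open>Sequences suffice for completeness, since the uniformity is given by a single (semi)norm.\<close>

definition norm_complete :: "('a, 'z) ring_scheme \<Rightarrow> ('a \<Rightarrow> real) \<Rightarrow> 'a set \<Rightarrow> bool" where
  "norm_complete A \<nu> S \<longleftrightarrow>
    (\<forall>s :: nat \<Rightarrow> 'a. range s \<subseteq> S \<and>
        (\<forall>e>0. \<exists>N. \<forall>m\<ge>N. \<forall>n\<ge>N. \<nu> (s m \<ominus>\<^bsub>A\<^esub> s n) < e) \<longrightarrow>
      (\<exists>l\<in>S. (\<lambda>n. \<nu> (s n \<ominus>\<^bsub>A\<^esub> l)) \<longlonglongrightarrow> 0))"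

text \<open>
  The library locale \<open>algebra\<close> is for commutative algebras, so compatibility of the scalar action
  with the product is stated here. The zero algebra is allowed.
\<close>

locale cstar_algebra =
  ring A + module complex_ring A
  for A :: "('a, 'z) cstar_algebra_scheme" (structure) +
  assumes smult_mult_left:
      "\<lbrakk>x \<in> carrier A; y \<in> carrier A\<rbrakk> \<Longrightarrow> (c \<odot> x) \<otimes> y = c \<odot> (x \<otimes> y)"
    and smult_mult_right:
      "\<lbrakk>x \<in> carrier A; y \<in> carrier A\<rbrakk> \<Longrightarrow> x \<otimes> (c \<odot> y) = c \<odot> (x \<otimes> y)"
    and adj_closed: "x \<in> carrier A \<Longrightarrow> adj A x \<in> carrier A"
    and adj_adj: "x \<in> carrier A \<Longrightarrow> adj A (adj A x) = x"
    and adj_add: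
      "\<lbrakk>x \<in> carrier A; y \<in> carrier A\<rbrakk> \<Longrightarrow> adj A (x \<oplus> y) = adj A x \<oplus> adj A y"
    and adj_smult: "x \<in> carrier A \<Longrightarrow> adj A (c \<odot> x) = cnj c \<odot> adj A x"
    and adj_mult:
      "\<lbrakk>x \<in> carrier A; y \<in> carrier A\<rbrakk> \<Longrightarrow> adj A (x \<otimes> y) = adj A y \<otimes> adj A x"
    and cnorm_eq_0_iff: "x \<in> carrier A \<Longrightarrow> cnorm A x = 0 \<longleftrightarrow> x = \<zero>"
    and cnorm_triangle:
      "\<lbrakk>x \<in> carrier A; y \<in> carrier A\<rbrakk> \<Longrightarrow> cnorm A (x \<oplus> y) \<le> cnorm A x + cnorm A y"
    and cnorm_smult: "x \<in> carrier A \<Longrightarrow> cnorm A (c \<odot> x) = cmod c * cnorm A x"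
    and cnorm_mult:
      "\<lbrakk>x \<in> carrier A; y \<in> carrier A\<rbrakk> \<Longrightarrow> cnorm A (x \<otimes> y) \<le> cnorm A x * cnorm A y"
    and cstar_identity: "x \<in> carrier A \<Longrightarrow> cnorm A (adj A x \<otimes> x) = (cnorm A x)\<^sup>2"
    and complete: "norm_complete A (cnorm A) (carrier A)"

definition center :: "('a, 'z) ring_scheme \<Rightarrow> 'a set" where
  "center A = {z \<in> carrier A. \<forall>x\<in>carrier A. z \<otimes>\<^bsub>A\<^esub> x = x \<otimes>\<^bsub>A\<^esub> z}"

definition cstar_hom ::
  "('a, 'y) cstar_algebra_scheme \<Rightarrow> ('b, 'z) cstar_algebra_scheme \<Rightarrow> ('a \<Rightarrow> 'b) set" where
  "cstar_hom A B = {h \<in> ring_hom A B. \<forall>x\<in>carrier A.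
    (\<forall>c. h (c \<odot>\<^bsub>A\<^esub> x) = c \<odot>\<^bsub>B\<^esub> h x) \<and> h (adj A x) = adj B (h x)}"


section \<open>The C*-algebra of continuous functions\<close>

text \<open>
  Elements of \<open>C(K)\<close> are continuous functions on \<open>topspace K\<close>, extended by \<open>undefined\<close>. Inserting
  \<open>0\<close> in the supremum makes the norm correct for empty \<open>K\<close> and changes nothing otherwise.
\<close>

definition cfun_algebra :: "'k topology \<Rightarrow> ('k \<Rightarrow> complex) cstar_algebra" where
  "cfun_algebra K =
    \<lparr>carrier = {f \<in> extensional (topspace K). continuous_map K euclidean f},
     mult = (\<lambda>f g. \<lambda>x\<in>topspace K. f x * g x),
     one = (\<lambda>x\<in>topspace K. 1),
     zero = (\<lambda>x\<in>topspace K. 0),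
     add = (\<lambda>f g. \<lambda>x\<in>topspace K. f x + g x),
     smult = (\<lambda>c f. \<lambda>x\<in>topspace K. c * f x),
     adj = (\<lambda>f. \<lambda>x\<in>topspace K. cnj (f x)),
     cnorm = (\<lambda>f. Sup (insert 0 ((\<lambda>x. cmod (f x)) ` topspace K)))\<rparr>"


section \<open>Tracial states\<close>

definition tracial_states :: "('a, 'z) cstar_algebra_scheme \<Rightarrow> ('a \<Rightarrow> complex) set" where
  "tracial_states A = {\<tau> \<in> extensional (carrier A).
     (\<forall>x\<in>carrier A. \<forall>y\<in>carrier A. \<tau> (x \<oplus>\<^bsub>A\<^esub> y) = \<tau> x + \<tau> y) \<and>
     (\<forall>c. \<forall>x\<in>carrier A. \<tau> (c \<odot>\<^bsub>A\<^esub> x) = c * \<tau> x) \<and>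
     (\<forall>x\<in>carrier A. \<tau> (adj A x \<otimes>\<^bsub>A\<^esub> x) \<in> \<real>\<^sub>\<ge>\<^sub>0) \<and>
     \<tau> \<one>\<^bsub>A\<^esub> = 1 \<and>
     (\<forall>x\<in>carrier A. \<forall>y\<in>carrier A. \<tau> (x \<otimes>\<^bsub>A\<^esub> y) = \<tau> (y \<otimes>\<^bsub>A\<^esub> x))}"

text \<open>The weak* topology is the topology of pointwise convergence on the algebra.\<close>

definition trace_space :: "('a, 'z) cstar_algebra_scheme \<Rightarrow> ('a \<Rightarrow> complex) topology" where
  "trace_space A =
    subtopology (product_topology (\<lambda>_. euclidean) (carrier A)) (tracial_states A)"

text \<open>
  Function types carry no vector space structure in the library, so \<open>convex\<close> and \<open>face_of\<close> do not
  apply to sets of functionals; the following are their analogues for functions on a set \<open>X\<close>.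
\<close>

definition convex_comb :: "'a set \<Rightarrow> real \<Rightarrow> ('a \<Rightarrow> complex) \<Rightarrow> ('a \<Rightarrow> complex) \<Rightarrow> 'a \<Rightarrow> complex"
  where "convex_comb X t \<rho> \<tau> = (\<lambda>x\<in>X. of_real (1 - t) * \<rho> x + of_real t * \<tau> x)"

definition is_face :: "'a set \<Rightarrow> ('a \<Rightarrow> complex) set \<Rightarrow> ('a \<Rightarrow> complex) set \<Rightarrow> bool" where
  "is_face X F S \<longleftrightarrow> F \<subseteq> S \<and>
     (\<forall>\<rho>\<in>F. \<forall>\<tau>\<in>F. \<forall>t\<in>{0..1}. convex_comb X t \<rho> \<tau> \<in> F) \<and>
     (\<forall>\<rho>\<in>S. \<forall>\<tau>\<in>S. \<forall>t\<in>{0<..<1}. convex_comb X t \<rho> \<tau> \<in> F \<longrightarrow> \<rho> \<in> F \<and> \<tau> \<in> F)"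


section \<open>W*-bundles\<close>

text \<open>Regular Borel probability measures on a (compact Hausdorff) space.\<close>

definition Prob :: "'k topology \<Rightarrow> 'k measure set" where
  "Prob K = {\<mu>. space \<mu> = topspace K \<and>
     sets \<mu> = sigma_sets (topspace K) {V. openin K V} \<and>
     prob_space \<mu> \<and>
     (\<forall>B\<in>sets \<mu>.
        emeasure \<mu> B = (INF V\<in>{V. openin K V \<and> B \<subseteq> V}. emeasure \<mu> V) \<and>
        emeasure \<mu> B = (SUP C\<in>{C. compactin K C \<and> C \<subseteq> B}. emeasure \<mu> C))}"

record ('a, 'k) wstar_bundle = "'a cstar_algebra" +
  base :: "'k topology"
  incl :: "('k \<Rightarrow> complex) \<Rightarrow> 'a"
  cexp :: "'a \<Rightarrow> 'k \<Rightarrow> complex"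

definition norm2 :: "('a, 'k, 'z) wstar_bundle_scheme \<Rightarrow> 'a \<Rightarrow> real" where
  "norm2 M a = sqrt (cnorm (cfun_algebra (base M)) (cexp M (adj M a \<otimes>\<^bsub>M\<^esub> a)))"

text \<open>
  \<open>C(K)\<close> is a separate algebra with the inclusion \<open>incl M\<close>, so ``identity on \<open>C(K)\<close>'' and
  ``\<open>C(K)\<close>-bimodule map'' are stated through \<open>incl M\<close>. The map \<open>cexp M\<close> takes values in a
  commutative algebra, so its positivity is the same as complete positivity.
\<close>

locale wstar_bundle = cstar_algebra M
  for M :: "('a, 'k, 'z) wstar_bundle_scheme" (structure) +
  assumes compact_base: "compact_space (base M)"
    and Hausdorff_base: "Hausdorff_space (base M)"
    and incl_hom: "incl M \<in> cstar_hom (cfun_algebra (base M)) M"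
    and incl_inj: "inj_on (incl M) (carrier (cfun_algebra (base M)))"
    and incl_central: "incl M ` carrier (cfun_algebra (base M)) \<subseteq> center M"
    and cexp_closed: "cexp M \<in> carrier M \<rightarrow> carrier (cfun_algebra (base M))"
    and cexp_add: "\<lbrakk>a \<in> carrier M; b \<in> carrier M\<rbrakk> \<Longrightarrow>
      cexp M (a \<oplus> b) = cexp M a \<oplus>\<^bsub>cfun_algebra (base M)\<^esub> cexp M b"
    and cexp_smult: "a \<in> carrier M \<Longrightarrow>
      cexp M (c \<odot> a) = c \<odot>\<^bsub>cfun_algebra (base M)\<^esub> cexp M a"
    and cexp_positive: "\<lbrakk>a \<in> carrier M; x \<in> topspace (base M)\<rbrakk> \<Longrightarrow>
      cexp M (adj M a \<otimes> a) x \<in> \<real>\<^sub>\<ge>\<^sub>0"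
    and cexp_contractive: "a \<in> carrier M \<Longrightarrow>
      cnorm (cfun_algebra (base M)) (cexp M a) \<le> cnorm M a"
    and cexp_incl: "f \<in> carrier (cfun_algebra (base M)) \<Longrightarrow> cexp M (incl M f) = f"
    and cexp_module_left: "\<lbrakk>f \<in> carrier (cfun_algebra (base M)); a \<in> carrier M\<rbrakk> \<Longrightarrow>
      cexp M (incl M f \<otimes> a) = f \<otimes>\<^bsub>cfun_algebra (base M)\<^esub> cexp M a"
    and cexp_module_right: "\<lbrakk>f \<in> carrier (cfun_algebra (base M)); a \<in> carrier M\<rbrakk> \<Longrightarrow>
      cexp M (a \<otimes> incl M f) = cexp M a \<otimes>\<^bsub>cfun_algebra (base M)\<^esub> f"
    and cexp_unital: "cexp M \<one> = \<one>\<^bsub>cfun_algebra (base M)\<^esub>"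
    and cexp_faithful: "\<lbrakk>a \<in> carrier M;
      cexp M (adj M a \<otimes> a) = \<zero>\<^bsub>cfun_algebra (base M)\<^esub>\<rbrakk> \<Longrightarrow> a = \<zero>"
    and cexp_tracial: "\<lbrakk>a \<in> carrier M; b \<in> carrier M\<rbrakk> \<Longrightarrow> cexp M (a \<otimes> b) = cexp M (b \<otimes> a)"
    and unit_ball_complete: "norm_complete M (norm2 M) {a \<in> carrier M. cnorm M a \<le> 1}"

definition bundle_trace ::
  "('a, 'k, 'z) wstar_bundle_scheme \<Rightarrow> 'k measure \<Rightarrow> 'a \<Rightarrow> complex" where
  "bundle_trace M \<mu> = (\<lambda>a\<in>carrier M. LINT x|\<mu>. cexp M a x)"

locale factorial_wstar_bundle = wstar_bundle M
  for M :: "('a, 'k, 'z) wstar_bundle_scheme" (structure) +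
  assumes bundle_traces_face:
      "is_face (carrier M) (bundle_trace M ` Prob (base M)) (tracial_states M)"
    and bundle_traces_closed:
      "closedin (trace_space M) (bundle_trace M ` Prob (base M))"


section \<open>Tracial ultraproducts\<close>

definition free_ultrafilter_on :: "'i set \<Rightarrow> 'i filter \<Rightarrow> bool" where
  "free_ultrafilter_on I \<U> \<longleftrightarrow>
     \<U> \<noteq> bot \<and> eventually (\<lambda>i. i \<in> I) \<U> \<and>
     (\<forall>P. eventually P \<U> \<or> eventually (\<lambda>i. \<not> P i) \<U>) \<and>
     \<Inter> {S. eventually (\<lambda>i. i \<in> S) \<U>} = {}"

definition linf_product ::
  "'i set \<Rightarrow> ('i \<Rightarrow> ('a, 'z) cstar_algebra_scheme) \<Rightarrow> ('i \<Rightarrow> 'a) cstar_algebra" where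
  "linf_product I M =
    \<lparr>carrier = {a \<in> \<Pi>\<^sub>E i\<in>I. carrier (M i). bdd_above ((\<lambda>i. cnorm (M i) (a i)) ` I)},
     mult = (\<lambda>a b. \<lambda>i\<in>I. a i \<otimes>\<^bsub>M i\<^esub> b i),
     one = (\<lambda>i\<in>I. \<one>\<^bsub>M i\<^esub>),
     zero = (\<lambda>i\<in>I. \<zero>\<^bsub>M i\<^esub>),
     add = (\<lambda>a b. \<lambda>i\<in>I. a i \<oplus>\<^bsub>M i\<^esub> b i),
     smult = (\<lambda>c a. \<lambda>i\<in>I. c \<odot>\<^bsub>M i\<^esub> a i),
     adj = (\<lambda>a. \<lambda>i\<in>I. adj (M i) (a i)),
     cnorm = (\<lambda>a. SUP i\<in>I. cnorm (M i) (a i))\<rparr>"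

text \<open>
  The quotient by a closed two-sided ideal: the ring is the library's \<open>A Quot J\<close>. Scaling a coset
  \<open>X\<close> is \<open>J + c X\<close> rather than \<open>c X\<close>, which would be wrong for \<open>c = 0\<close>.
\<close>

definition cstar_quotient ::
  "('a, 'z) cstar_algebra_scheme \<Rightarrow> 'a set \<Rightarrow> 'a set cstar_algebra" where
  "cstar_quotient A J =
    \<lparr>carrier = carrier (A Quot J), mult = mult (A Quot J), one = one (A Quot J),
     zero = zero (A Quot J), add = add (A Quot J),
     smult = (\<lambda>c X. J <+>\<^bsub>A\<^esub> (smult A c ` X)),
     adj = (\<lambda>X. adj A ` X),
     cnorm = (\<lambda>X. INF x\<in>X. cnorm A x)\<rparr>"

definition trace_kernel ::
  "'i set \<Rightarrow> 'i filter \<Rightarrow> ('i \<Rightarrow> ('a, 'k, 'z) wstar_bundle_scheme) \<Rightarrow> ('i \<Rightarrow> 'a) set" where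
  "trace_kernel I \<U> M =
     {a \<in> carrier (linf_product I M). ((\<lambda>i. norm2 (M i) (a i)) \<longlongrightarrow> 0) \<U>}"

definition tracial_ultraproduct ::
  "'i set \<Rightarrow> 'i filter \<Rightarrow> ('i \<Rightarrow> ('a, 'k, 'z) wstar_bundle_scheme) \<Rightarrow> ('i \<Rightarrow> 'a) set cstar_algebra"
  where "tracial_ultraproduct I \<U> M = cstar_quotient (linf_product I M) (trace_kernel I \<U> M)"

text \<open>
  The ultraproduct of the centers, identified with the set of those elements of the tracial
  ultraproduct that have a representing family of central elements.
\<close>

definition center_ultraproduct ::
  "'i set \<Rightarrow> 'i filter \<Rightarrow> ('i \<Rightarrow> ('a, 'k, 'z) wstar_bundle_scheme) \<Rightarrow> ('i \<Rightarrow> 'a) set set" where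
  "center_ultraproduct I \<U> M =
     {trace_kernel I \<U> M +>\<^bsub>linf_product I M\<^esub> a | a.
        a \<in> carrier (linf_product I M) \<and> (\<forall>i\<in>I. a i \<in> center (M i))}"

end

theory Submission
  imports Defs "HOL-Probability.Giry_Monad"
begin

text \<open>
  Let \<open>a\<close> represent a central element of the ultraproduct. It suffices to show, for a single factorial
  bundle and with a universal constant, that \<open>a\<close> is 2-norm close to \<open>E(a)\<close> whenever it approximately
  commutes with every unitary; the family \<open>E(a\<^sub>i)\<close> is then a central representative. The estimate can
  be checked at each point \<open>x\<close> of the base, and there only one property of the trace
  \<open>\<tau> = E(-)(x)\<close> matters: it is an extreme trace, because bundle traces form a
  face and each of them is determined by its restriction to \<open>C(K)\<close>.

  For an extreme trace \<open>\<tau>\<close> and a self-adjoint contraction \<open>a\<close> with \<open>\<tau>(a) = 0\<close>, take a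
  2-norm minimising sequence \<open>y\<^sub>n\<close> in a midpoint-convex set of elements resembling the averages of
  unitary conjugates of \<open>a\<close>. The functionals \<open>\<tau>((1 \<plusminus> y\<^sub>n) -)\<close> converge to tracial states with mean
  \<open>\<tau>\<close>, so \<open>y\<^sub>n\<close> tends weakly to \<open>0\<close>. If \<open>a\<close> is \<open>\<delta>\<close>-close in 2-norm to all its conjugates, then
  \<open>\<tau>(a y\<^sub>n)\<close> stays above \<open>\<parallel>a\<parallel>\<^sub>2\<^sup>2 - \<delta> \<parallel>a\<parallel>\<^sub>2\<close>, whence \<open>\<parallel>a\<parallel>\<^sub>2 \<le> \<delta>\<close>.
\<close>

lemma complex_ring_simps [simp]:
  "carrier complex_ring = UNIV" "mult complex_ring = (*)" "one complex_ring = 1"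
  "zero complex_ring = 0" "add complex_ring = (+)"
  by (simp_all add: complex_ring_def)

subsection \<open>Square roots and unitaries in C*-algebras\<close>

context cstar_algebra
begin

lemma ring_A: "ring A"
  by unfold_locales

lemmas A_rules = ring.ring_simprules[OF ring_A]

lemma scale_closed [simp]: "x \<in> carrier A \<Longrightarrow> c \<odot> x \<in> carrier A"
  using smult_closed by simp

declare adj_closed [simp]

lemma scale_add: "x \<in> carrier A \<Longrightarrow> (c + d) \<odot> x = c \<odot> x \<oplus> d \<odot> x"
  using smult_l_distr[of c d x] by simp

lemma scale_scale: "x \<in> carrier A \<Longrightarrow> c \<odot> (d \<odot> x) = (c * d) \<odot> x"
  using smult_assoc1[of c d x] by simp

lemma scale_distrib: "x \<in> carrier A \<Longrightarrow> y \<in> carrier A \<Longrightarrow> c \<odot> (x \<oplus> y) = c \<odot> x \<oplus> c \<odot> y"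
  using smult_r_distr[of c x y] by simp

lemma scale_one [simp]: "x \<in> carrier A \<Longrightarrow> 1 \<odot> x = x"
  using smult_one[of x] by simp

lemma scale_zero_left [simp]: "x \<in> carrier A \<Longrightarrow> 0 \<odot> x = \<zero>"
  using smult_l_null[of x] by simp

lemma scale_zero_right [simp]: "c \<odot> \<zero> = \<zero>"
  using smult_r_null[of c] by simp

lemma minus_scale: "x \<in> carrier A \<Longrightarrow> \<ominus> x = (-1) \<odot> x"
proof -
  assume x: "x \<in> carrier A"
  have "(-1) \<odot> x \<oplus> x = \<zero>"
    using scale_add[of x "-1" 1] x by simp
  then show ?thesis
    by (metis x abelian_group.minus_equality ring.is_abelian_group ring_A scale_closed)
qed

lemma diff_scale: "x \<in> carrier A \<Longrightarrow> y \<in> carrier A \<Longrightarrow> x \<ominus> y = x \<oplus> (-1) \<odot> y"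
  by (simp add: a_minus_def minus_scale)

lemma diff_eq_zero_iff: "x \<in> carrier A \<Longrightarrow> y \<in> carrier A \<Longrightarrow> x \<ominus> y = \<zero> \<longleftrightarrow> x = y"
proof -
  assume "x \<in> carrier A" "y \<in> carrier A"
  moreover from this have "x = (x \<ominus> y) \<oplus> y"
    by (simp add: a_minus_def A_rules)
  ultimately show ?thesis
    by (metis A_rules(8) A_rules(14) A_rules(16))
qed

text \<open>A rewriting system towards sorted sums of scalar multiples of words: scalars move out of
  products and into sums, adjoints move to the letters, and \<open>\<ominus>\<close> becomes scaling
  by -1. Cancellation is not included, so proofs that rely on it supply their own
  \<open>cancel\<close> facts.\<close>

lemmas lin_rules = ring.ring_simprules(7,10,11,13,22,23)[OF ring_A] scale_distrib scale_scale
  smult_mult_left smult_mult_right diff_scale minus_scale adj_add adj_smult adj_mult adj_adj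

lemma adj_zero [simp]: "adj A \<zero> = \<zero>"
  by (metis adj_closed adj_smult A_rules(2) complex_cnj_zero scale_zero_left)

lemma adj_one [simp]: "adj A \<one> = \<one>"
  by (metis A_rules(6,12) adj_adj adj_closed adj_mult)

lemma adj_diff: "x \<in> carrier A \<Longrightarrow> y \<in> carrier A \<Longrightarrow> adj A (x \<ominus> y) = adj A x \<ominus> adj A y"
  by (simp add: diff_scale adj_add adj_smult)

lemma cnorm_zero [simp]: "cnorm A \<zero> = 0"
  by (simp add: cnorm_eq_0_iff)

lemma cnorm_nonneg [simp]: "x \<in> carrier A \<Longrightarrow> 0 \<le> cnorm A x"
proof -
  assume x: "x \<in> carrier A"
  have "cnorm A (x \<ominus> x) \<le> cnorm A x + cnorm A ((-1) \<odot> x)"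
    using x by (simp add: diff_scale cnorm_triangle)
  moreover have "x \<ominus> x = \<zero>"
    using x diff_eq_zero_iff by blast
  ultimately show ?thesis
    using x by (simp add: cnorm_smult)
qed

lemma cnorm_diff_commute:
  "x \<in> carrier A \<Longrightarrow> y \<in> carrier A \<Longrightarrow> cnorm A (x \<ominus> y) = cnorm A (y \<ominus> x)"
proof -
  assume xy: "x \<in> carrier A" "y \<in> carrier A"
  have "x \<ominus> y = (-1) \<odot> (y \<ominus> x)"
    using xy by (simp add: lin_rules)
  then show ?thesis
    using xy by (simp add: cnorm_smult)
qed

lemma cnorm_diff_triangle:
  assumes "x \<in> carrier A" "y \<in> carrier A" "z \<in> carrier A"
  shows "cnorm A (x \<ominus> z) \<le> cnorm A (x \<ominus> y) + cnorm A (y \<ominus> z)"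
proof -
  have "x \<ominus> z = (x \<ominus> y) \<oplus> (y \<ominus> z)"
    using assms by (simp add: a_minus_def A_rules)
  then show ?thesis
    using assms cnorm_triangle by simp
qed

text \<open>The C*-identity bounds the square of \<open>cnorm A x\<close> by
  \<open>cnorm A (adj A x) * cnorm A x\<close>. Cancelling one factor gives one inequality, and
  applying it to \<open>adj A x\<close> gives the other.\<close>

lemma cnorm_adj [simp]: "x \<in> carrier A \<Longrightarrow> cnorm A (adj A x) = cnorm A x"
proof -
  have le: "cnorm A x \<le> cnorm A (adj A x)" if x: "x \<in> carrier A" for x
  proof (cases "cnorm A x = 0")
    case False
    then have "cnorm A x > 0"
      using x cnorm_nonneg[of x] by linarith
    moreover have "cnorm A x * cnorm A x \<le> cnorm A (adj A x) * cnorm A x"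
      using cstar_identity[OF x] cnorm_mult[of "adj A x" x] x by (simp add: power2_eq_square)
    ultimately show ?thesis
      by simp
  qed (use x in simp)
  show "x \<in> carrier A \<Longrightarrow> cnorm A (adj A x) = cnorm A x"
    using le[of x] le[of "adj A x"] by (simp add: adj_adj)
qed

text \<open>The norm of \<open>\<one>\<close> equals its own square, so it is 0 or 1; the value 0
  occurs in the zero algebra, hence the inequality. The C*-identity carries the bound over to
  \<open>u\<close>.\<close>

lemma cnorm_isometry_le_1:
  assumes "u \<in> carrier A" "adj A u \<otimes> u = \<one>"
  shows "cnorm A u \<le> 1"
proof -
  have "cnorm A \<one> = (cnorm A \<one>)\<^sup>2"
    using cstar_identity[of \<one>] by (simp add: A_rules)
  then have "cnorm A \<one> \<le> 1"
    by (metis power2_eq_square mult_cancel_right1 order.refl zero_le_one)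
  then have "(cnorm A u)\<^sup>2 \<le> 1"
    using cstar_identity[OF assms(1)] assms(2) by simp
  then show ?thesis
    by (simp add: abs_square_le_1 power_le_one_iff abs_le_iff)
qed

lemma limit_unique:
  assumes "\<And>n. s n \<in> carrier A" "x \<in> carrier A" "y \<in> carrier A"
    and "(\<lambda>n. cnorm A (s n \<ominus> x)) \<longlonglongrightarrow> 0" "(\<lambda>n. cnorm A (s n \<ominus> y)) \<longlonglongrightarrow> 0"
  shows "x = y"
proof -
  have "(\<lambda>n. cnorm A (s n \<ominus> x) + cnorm A (s n \<ominus> y)) \<longlonglongrightarrow> 0 + 0"
    using assms by (intro tendsto_add)
  moreover have "cnorm A (x \<ominus> y) \<le> cnorm A (s n \<ominus> x) + cnorm A (s n \<ominus> y)" for n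
    using cnorm_diff_triangle[of x "s n" y] cnorm_diff_commute[of x "s n"] assms by simp
  ultimately have "cnorm A (x \<ominus> y) \<le> 0"
    by (intro LIMSEQ_le_const) auto
  then have "cnorm A (x \<ominus> y) = 0"
    using assms(2,3) by (intro antisym) auto
  then show ?thesis
    using assms(2,3) by (simp add: cnorm_eq_0_iff diff_eq_zero_iff)
qed

text \<open>A fixed point iteration takes the place of functional calculus:
  \<open>c = \<one> \<ominus> l\<close>, where \<open>l\<close> is the limit of the iterates of
  \<open>f\<close> from \<open>\<zero>\<close>. Each iterate is self-adjoint and commutes with
  everything that commutes with \<open>a\<close>, and both properties survive norm limits. The
  strict bound on \<open>cnorm A a\<close> makes \<open>f\<close> a contraction.\<close>

lemma exists_sqrt_one_minus:
  assumes a: "a \<in> carrier A" "adj A a = a" "cnorm A a < 1"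
  obtains c where "c \<in> carrier A" "adj A c = c" "c \<otimes> c = \<one> \<ominus> a"
    "\<And>x. x \<in> carrier A \<Longrightarrow> x \<otimes> a = a \<otimes> x \<Longrightarrow> x \<otimes> c = c \<otimes> x"
proof -
  define s where "s = cnorm A a"
  have s: "0 \<le> s" "s < 1"
    using a by (simp_all add: s_def)
  \<comment> \<open>\<open>1 - b\<close> is a square root of \<open>1 - a\<close> iff \<open>b\<close> is a fixed point of \<open>f\<close>, a contraction on the ball of radius \<open>s\<close>.\<close>
  define f where "f b = (1/2) \<odot> (a \<oplus> b \<otimes> b)" for b
  have f_closed: "f b \<in> carrier A" if "b \<in> carrier A" for b
    using that a by (simp add: f_def)
  have f_norm: "cnorm A (f b) \<le> s" if b: "b \<in> carrier A" "cnorm A b \<le> s" for b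
  proof -
    have "cnorm A (b \<otimes> b) \<le> s * s"
      using cnorm_mult[of b b] b mult_mono[of "cnorm A b" s "cnorm A b" s] s by simp
    also have "\<dots> \<le> s"
      using s mult_left_le[of s s] by simp
    finally have "cnorm A (a \<oplus> b \<otimes> b) \<le> s + s"
      using cnorm_triangle[of a "b \<otimes> b"] a b by (simp add: s_def)
    then show ?thesis
      using a b by (simp add: f_def cnorm_smult norm_divide)
  qed
  have f_contr: "cnorm A (f b \<ominus> f d) \<le> s * cnorm A (b \<ominus> d)"
    if b: "b \<in> carrier A" "cnorm A b \<le> s" and d: "d \<in> carrier A" "cnorm A d \<le> s" for b d
  proof -
    have "f b \<ominus> f d = (1/2) \<odot> (b \<otimes> b \<ominus> d \<otimes> d)"
    proof -
      have "(1/2) \<odot> a \<oplus> (-(1/2)) \<odot> a = \<zero>"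
        using a scale_add[of a "1/2" "-(1/2)"] by simp
      then have cancel: "(1/2) \<odot> a \<oplus> (-(1/2) \<odot> a \<oplus> y) = y" if "y \<in> carrier A" for y
        using that a by (metis A_rules(7,8) scale_closed)
      show ?thesis
        using a b d by (simp add: f_def lin_rules cancel)
    qed
    \<comment> \<open>Difference of squares in a noncommutative ring. Each of the two summands costs
      a factor \<open>s\<close>, and the 1/2 in \<open>f\<close> brings the total back to
      \<open>s\<close>.\<close>
    moreover have "b \<otimes> b \<ominus> d \<otimes> d = b \<otimes> (b \<ominus> d) \<oplus> (b \<ominus> d) \<otimes> d"
    proof -
      have cancel: "b \<otimes> d \<oplus> ((-1) \<odot> (b \<otimes> d) \<oplus> y) = y" if "y \<in> carrier A" for y
        using that b d A_rules(17)[of "b \<otimes> d" y] minus_scale[of "b \<otimes> d"] by simp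
      show ?thesis
        using b d by (simp add: lin_rules cancel)
    qed
    moreover have "cnorm A (b \<otimes> (b \<ominus> d)) \<le> s * cnorm A (b \<ominus> d)"
      using b d cnorm_mult[of b "b \<ominus> d"] mult_right_mono[of "cnorm A b" s "cnorm A (b \<ominus> d)"] by simp
    moreover have "cnorm A ((b \<ominus> d) \<otimes> d) \<le> s * cnorm A (b \<ominus> d)"
      using b d cnorm_mult[of "b \<ominus> d" d] mult_left_mono[of "cnorm A d" s "cnorm A (b \<ominus> d)"]
      by (simp add: mult.commute)
    ultimately show ?thesis
      using b d cnorm_triangle[of "b \<otimes> (b \<ominus> d)" "(b \<ominus> d) \<otimes> d"]
      by (simp add: cnorm_smult norm_divide)
  qed
  define b where "b n = (f ^^ n) \<zero>" for n
  have b_Suc: "b (Suc n) = f (b n)" for n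
    by (simp add: b_def)
  have b: "b n \<in> carrier A \<and> cnorm A (b n) \<le> s \<and> adj A (b n) = b n
      \<and> (\<forall>x\<in>carrier A. x \<otimes> a = a \<otimes> x \<longrightarrow> x \<otimes> b n = b n \<otimes> x)" for n
  proof (induction n)
    case 0
    then show ?case
      using s by (simp add: b_def)
  next
    case (Suc n)
    have "x \<otimes> b (Suc n) = b (Suc n) \<otimes> x" if x: "x \<in> carrier A" "x \<otimes> a = a \<otimes> x" for x
    proof -
      have bn: "b n \<in> carrier A" "x \<otimes> b n = b n \<otimes> x"
        using Suc x by auto
      then have "x \<otimes> (b n \<otimes> b n) = b n \<otimes> (b n \<otimes> x)"
        using x(1) by (metis A_rules(11))
      then show ?thesis
        using x bn(1) a(1) by (simp add: b_Suc f_def lin_rules)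
    qed
    moreover have "adj A (b (Suc n)) = b (Suc n)"
      using a(1,2) Suc.IH[THEN conjunct1] Suc.IH[THEN conjunct2, THEN conjunct2, THEN conjunct1]
      by (simp add: b_Suc f_def lin_rules)
    ultimately show ?case
      using Suc f_closed f_norm by (simp add: b_Suc)
  qed
  have b_Cauchy: "cnorm A (b (n + k) \<ominus> b n) \<le> 2 * s ^ n" for n k
  proof (induction n)
    case 0
    have "cnorm A (b k \<ominus> \<zero>) \<le> 1"
      using b[of k] s by (simp add: diff_scale)
    then show ?case
      by (simp add: b_def)
  next
    case (Suc n)
    have "cnorm A (b (Suc n + k) \<ominus> b (Suc n)) \<le> s * cnorm A (b (n + k) \<ominus> b n)"
      using f_contr b by (simp add: b_Suc)
    also have "\<dots> \<le> s * (2 * s ^ n)"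
      using Suc s by (intro mult_left_mono) auto
    finally show ?case
      by simp
  qed
  have "\<exists>N. \<forall>m\<ge>N. \<forall>n\<ge>N. cnorm A (b m \<ominus> b n) < e" if e: "e > 0" for e
  proof -
    have "(\<lambda>n. 2 * s ^ n) \<longlonglongrightarrow> 2 * 0"
      using s by (intro tendsto_mult_left LIMSEQ_power_zero) auto
    then obtain N where N: "2 * s ^ n < e" if "n \<ge> N" for n
      using e by (metis (no_types, lifting) eventually_sequentially mult_zero_right order_tendstoD(2))
    have le: "cnorm A (b m \<ominus> b n) < e" if "m \<ge> n" "n \<ge> N" for m n
      using b_Cauchy[of n "m - n"] N[of n] that by simp
    have "cnorm A (b m \<ominus> b n) < e" if "m \<ge> N" "n \<ge> N" for m n
      using le[of n m] le[of m n] that b cnorm_diff_commute[of "b m" "b n"]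
      by (cases "m \<ge> n") auto
    then show ?thesis by blast
  qed
  moreover have "range b \<subseteq> carrier A"
    using b by blast
  ultimately obtain l where l: "l \<in> carrier A" and lim: "(\<lambda>n. cnorm A (b n \<ominus> l)) \<longlonglongrightarrow> 0"
    using complete[unfolded norm_complete_def, rule_format, of b] by blast
  have l_norm: "cnorm A l \<le> s"
  proof -
    have "cnorm A l \<le> s + cnorm A (b n \<ominus> l)" for n
    proof -
      have "cnorm A (l \<ominus> \<zero>) \<le> cnorm A (l \<ominus> b n) + cnorm A (b n \<ominus> \<zero>)"
        using l b by (intro cnorm_diff_triangle) auto
      then show ?thesis
        using l b[of n] cnorm_diff_commute[of l "b n"] by (simp add: diff_scale)
    qed
    moreover have "(\<lambda>n. s + cnorm A (b n \<ominus> l)) \<longlonglongrightarrow> s + 0"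
      by (intro tendsto_add tendsto_const lim)
    ultimately show ?thesis
      by (intro LIMSEQ_le_const[of _ s]) auto
  qed
  \<comment> \<open>The shifted sequence tends to \<open>l\<close> as a subsequence and to
    \<open>f l\<close> by the contraction estimate.\<close>
  have f_l: "f l = l"
  proof (rule limit_unique)
    show "(\<lambda>n. cnorm A (b (Suc n) \<ominus> l)) \<longlonglongrightarrow> 0"
      using lim by (rule LIMSEQ_Suc)
    have lim': "(\<lambda>n. s * cnorm A (b n \<ominus> l)) \<longlonglongrightarrow> s * 0"
      by (intro tendsto_mult_left lim)
    have "cnorm A (b (Suc n) \<ominus> f l) \<le> s * cnorm A (b n \<ominus> l)" for n
      using f_contr b l l_norm by (simp add: b_Suc)
    then show "(\<lambda>n. cnorm A (b (Suc n) \<ominus> f l)) \<longlonglongrightarrow> 0"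
      using b l f_closed by (intro Lim_null_comparison[OF _ lim'[simplified]]) auto
  qed (use b l f_closed in auto)
  have l_adj: "adj A l = l"
  proof (rule limit_unique)
    have "cnorm A (b n \<ominus> adj A l) = cnorm A (b n \<ominus> l)" for n
      using b[of n] l cnorm_adj[of "b n \<ominus> l"] by (simp add: adj_diff)
    then show "(\<lambda>n. cnorm A (b n \<ominus> adj A l)) \<longlonglongrightarrow> 0"
      using lim by simp
  qed (use b l lim in auto)
  have l_comm: "x \<otimes> l = l \<otimes> x" if x: "x \<in> carrier A" "x \<otimes> a = a \<otimes> x" for x
  proof (rule limit_unique)
    have lim': "(\<lambda>n. cnorm A x * cnorm A (b n \<ominus> l)) \<longlonglongrightarrow> cnorm A x * 0"
      by (intro tendsto_mult_left lim)
    have "cnorm A (x \<otimes> b n \<ominus> x \<otimes> l) \<le> cnorm A x * cnorm A (b n \<ominus> l)" for n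
      using b[of n] l x cnorm_mult[of x "b n \<ominus> l"] by (simp add: lin_rules)
    then show "(\<lambda>n. cnorm A (x \<otimes> b n \<ominus> x \<otimes> l)) \<longlonglongrightarrow> 0"
      using lim' b l x by (intro Lim_null_comparison[OF _ lim'[simplified]]) auto
    have "cnorm A (x \<otimes> b n \<ominus> l \<otimes> x) \<le> cnorm A x * cnorm A (b n \<ominus> l)" for n
      using b[of n] l x cnorm_mult[of "b n \<ominus> l" x] by (simp add: lin_rules mult.commute)
    then show "(\<lambda>n. cnorm A (x \<otimes> b n \<ominus> l \<otimes> x)) \<longlonglongrightarrow> 0"
      using lim' b l x by (intro Lim_null_comparison[OF _ lim'[simplified]]) auto
  qed (use b l x in auto)
  show thesis
  proof (rule that[of "\<one> \<ominus> l"])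
    \<comment> \<open>Doubling the fixed point equation gives \<open>l \<otimes> l\<close> as 2
      \<open>l\<close> minus \<open>a\<close>, which cancels the linear terms in the square of
      \<open>\<one> \<ominus> l\<close>.\<close>
    have "2 \<odot> f l = a \<oplus> l \<otimes> l"
      using a l by (simp add: f_def scale_scale)
    then have "2 \<odot> l = a \<oplus> l \<otimes> l"
      using f_l by simp
    moreover have "l \<otimes> l = \<ominus> a \<oplus> (a \<oplus> l \<otimes> l)"
      using a l by (intro A_rules(18)[symmetric]) auto
    ultimately have *: "l \<otimes> l = (-1) \<odot> a \<oplus> 2 \<odot> l"
      using a minus_scale by simp
    have "(\<one> \<ominus> l) \<otimes> (\<one> \<ominus> l) = \<one> \<oplus> (((-1) \<odot> l \<oplus> (-1) \<odot> l) \<oplus> l \<otimes> l)"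
      using l by (simp add: lin_rules)
    also have "(-1) \<odot> l \<oplus> (-1) \<odot> l = (-2) \<odot> l"
      using l by (simp flip: scale_add)
    also have "(-2) \<odot> l \<oplus> l \<otimes> l = (-1) \<odot> a \<oplus> ((-2) \<odot> l \<oplus> 2 \<odot> l)"
      using a l unfolding * by (intro A_rules(22)) auto
    also have "(-2) \<odot> l \<oplus> 2 \<odot> l = \<zero>"
      using l by (simp flip: scale_add)
    finally show "(\<one> \<ominus> l) \<otimes> (\<one> \<ominus> l) = \<one> \<ominus> a"
      using a by (simp add: diff_scale)
    show "x \<otimes> (\<one> \<ominus> l) = (\<one> \<ominus> l) \<otimes> x" if "x \<in> carrier A" "x \<otimes> a = a \<otimes> x" for x
      using that l l_comm[OF that] by (simp add: lin_rules)
  qed (use l l_adj in \<open>auto simp: adj_diff\<close>)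
qed

end

section \<open>Unitaries and their linear span\<close>

definition unitaries :: "('a, 'z) cstar_algebra_scheme \<Rightarrow> 'a set" where
  "unitaries A = {u \<in> carrier A. adj A u \<otimes>\<^bsub>A\<^esub> u = \<one>\<^bsub>A\<^esub> \<and> u \<otimes>\<^bsub>A\<^esub> adj A u = \<one>\<^bsub>A\<^esub>}"

context cstar_algebra
begin

lemma unitary_closed: "u \<in> unitaries A \<Longrightarrow> u \<in> carrier A"
  by (simp add: unitaries_def)

lemma unitary_cancel:
  assumes "u \<in> unitaries A" "x \<in> carrier A"
  shows "adj A u \<otimes> (u \<otimes> x) = x" "u \<otimes> (adj A u \<otimes> x) = x"
proof -
  have u: "u \<in> carrier A" "adj A u \<otimes> u = \<one>" "u \<otimes> adj A u = \<one>"
    using assms(1) by (auto simp: unitaries_def)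
  show "adj A u \<otimes> (u \<otimes> x) = x"
    using A_rules(11)[of "adj A u" u x] u assms(2) by simp
  show "u \<otimes> (adj A u \<otimes> x) = x"
    using A_rules(11)[of u "adj A u" x] u assms(2) by simp
qed

lemma adj_unitary: "u \<in> unitaries A \<Longrightarrow> adj A u \<in> unitaries A"
  by (simp add: unitaries_def adj_adj)

lemma one_unitary: "\<one> \<in> unitaries A"
  by (simp add: unitaries_def)

lemma mult_unitary:
  assumes "u \<in> unitaries A" "v \<in> unitaries A"
  shows "u \<otimes> v \<in> unitaries A"
proof -
  have uv: "u \<in> carrier A" "adj A u \<otimes> u = \<one>" "u \<otimes> adj A u = \<one>"
    "v \<in> carrier A" "adj A v \<otimes> v = \<one>" "v \<otimes> adj A v = \<one>"
    using assms by (auto simp: unitaries_def)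
  then show ?thesis
    using unitary_cancel(1)[OF assms(1), of v] unitary_cancel(2)[OF assms(2), of "adj A u"]
    by (simp add: unitaries_def adj_mult A_rules(11))
qed

lemma cnorm_unitary: "u \<in> unitaries A \<Longrightarrow> cnorm A u \<le> 1"
  by (simp add: unitaries_def cnorm_isometry_le_1)

text \<open>With \<open>c\<close> a square root of \<open>\<one> \<ominus> x \<otimes> x\<close>,
  the unitary is \<open>x \<oplus> \<i> \<odot> c\<close>, the analogue of cosine plus i times sine.
  Since \<open>x\<close> commutes with its own square, it commutes with \<open>c\<close>, and the
  cross terms cancel.\<close>

lemma selfadjoint_contraction_unitary:
  assumes x: "x \<in> carrier A" "adj A x = x" "cnorm A x < 1"
  obtains u where "u \<in> unitaries A" "x = (1/2) \<odot> (u \<oplus> adj A u)"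
proof -
  have "cnorm A (x \<otimes> x) < 1"
    using cstar_identity[of x] x by (simp add: abs_square_less_1)
  then obtain c where c: "c \<in> carrier A" "adj A c = c" "c \<otimes> c = \<one> \<ominus> x \<otimes> x"
    and comm: "\<And>z. z \<in> carrier A \<Longrightarrow> z \<otimes> (x \<otimes> x) = (x \<otimes> x) \<otimes> z \<Longrightarrow> z \<otimes> c = c \<otimes> z"
    using exists_sqrt_one_minus[of "x \<otimes> x"] x by (metis A_rules(5) adj_mult)
  have xc: "x \<otimes> c = c \<otimes> x"
    using comm[of x] x by (simp add: A_rules(11))
  have cancel: "w \<oplus> ((-1) \<odot> w \<oplus> y) = y" "(-1) \<odot> w \<oplus> (w \<oplus> y) = y"
    if "w \<in> carrier A" "y \<in> carrier A" for w y
    using A_rules(17,18)[OF that] minus_scale[OF that(1)] by simp_all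
  have neg: "w \<oplus> (-1) \<odot> w = \<zero>" if "w \<in> carrier A" for w
    using A_rules(16)[OF that] minus_scale[OF that] by simp
  have cancel': "\<i> \<odot> w \<oplus> ((-\<i>) \<odot> w \<oplus> y) = y" "(-\<i>) \<odot> w \<oplus> (\<i> \<odot> w \<oplus> y) = y"
    if "w \<in> carrier A" "y \<in> carrier A" for w y
    using cancel[of "\<i> \<odot> w" y] that by (simp_all add: scale_scale)
  let ?u = "x \<oplus> \<i> \<odot> c"
  have u_adj: "adj A ?u = x \<oplus> (-\<i>) \<odot> c"
    using x c by (simp add: adj_add adj_smult)
  have "adj A ?u \<otimes> ?u = \<one>" "?u \<otimes> adj A ?u = \<one>"
    unfolding u_adj using x(1) c(1,3)
    by (simp_all add: lin_rules xc neg cancel cancel')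
  then have "?u \<in> unitaries A"
    using x c by (simp add: unitaries_def)
  moreover have "x = (1/2) \<odot> (?u \<oplus> adj A ?u)"
  proof -
    have "?u \<oplus> adj A ?u = x \<oplus> x"
      unfolding u_adj using x c cancel'[of c \<zero>] by (simp add: lin_rules)
    also have "\<dots> = 2 \<odot> x"
      using x scale_add[of x 1 1] by simp
    finally show ?thesis
      using x by (simp add: scale_scale)
  qed
  ultimately show thesis
    by (rule that)
qed

lemma selfadjoint_parts:
  assumes "a \<in> carrier A"
  obtains h k where "h \<in> carrier A" "k \<in> carrier A" "adj A h = h" "adj A k = k"
    "a = h \<oplus> \<i> \<odot> k" "h = (1/2) \<odot> (a \<oplus> adj A a)" "k = (-\<i>/2) \<odot> (a \<ominus> adj A a)"
proof -
  let ?h = "(1/2) \<odot> (a \<oplus> adj A a)" and ?k = "(-\<i>/2) \<odot> (a \<ominus> adj A a)"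
  have "?h \<in> carrier A" "?k \<in> carrier A" using assms by auto
  moreover have "adj A ?h = ?h" "adj A ?k = ?k"
    using assms by (simp_all add: lin_rules)
  moreover have "a = ?h \<oplus> \<i> \<odot> ?k"
  proof -
    have "?h \<oplus> \<i> \<odot> ?k = ((1/2) \<odot> a \<oplus> (1/2) \<odot> a) \<oplus> ((1/2) \<odot> adj A a \<oplus> (-1/2) \<odot> adj A a)"
      using assms by (simp add: lin_rules)
    also have "\<dots> = a"
      using assms by (simp flip: scale_add)
    finally show ?thesis ..
  qed
  ultimately show thesis
    using that by blast
qed

text \<open>Unitaries span the algebra: a self-adjoint strict contraction is the average of a
  unitary and its adjoint, and rescaling and splitting into real and imaginary parts reach every
  element. The argument is algebraic, so it applies to a functional known only as a pointwise
  limit.\<close>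

lemma tracial_if_unitary_invariant:
  fixes \<phi> :: "'a \<Rightarrow> complex"
  assumes add: "\<And>x y. x \<in> carrier A \<Longrightarrow> y \<in> carrier A \<Longrightarrow> \<phi> (x \<oplus> y) = \<phi> x + \<phi> y"
    and scale: "\<And>c x. x \<in> carrier A \<Longrightarrow> \<phi> (c \<odot> x) = c * \<phi> x"
    and inv: "\<And>u z. u \<in> unitaries A \<Longrightarrow> z \<in> carrier A \<Longrightarrow> \<phi> (u \<otimes> z) = \<phi> (z \<otimes> u)"
    and x: "x \<in> carrier A" and z: "z \<in> carrier A"
  shows "\<phi> (x \<otimes> z) = \<phi> (z \<otimes> x)"
proof -
  have contr: "\<phi> (h \<otimes> z) = \<phi> (z \<otimes> h)" if h: "h \<in> carrier A" "adj A h = h" "cnorm A h < 1" for h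
  proof -
    obtain u where u: "u \<in> unitaries A" "h = (1/2) \<odot> (u \<oplus> adj A u)"
      using selfadjoint_contraction_unitary[OF h] by metis
    then show ?thesis
      using z unitary_closed[of u] inv[of u z] inv[OF adj_unitary, of u z]
      by (simp add: lin_rules add scale)
  qed
  have sa: "\<phi> (h \<otimes> z) = \<phi> (z \<otimes> h)" if h: "h \<in> carrier A" "adj A h = h" for h
  proof -
    \<comment> \<open>The added 1 keeps \<open>r\<close> nonzero and makes the rescaled element a
      strict contraction.\<close>
    define r where "r = complex_of_real (cnorm A h + 1)"
    have r: "r \<noteq> 0" "cnj r = r" "cmod r = cnorm A h + 1"
      using cnorm_nonneg[OF h(1)] by (auto simp: r_def simp flip: of_real_add)
    have pos: "0 < cnorm A h + 1"
      using cnorm_nonneg[OF h(1)] by linarith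
    have "cnorm A ((1/r) \<odot> h) < 1"
      using h r pos by (simp add: cnorm_smult norm_divide)
    then have "\<phi> (((1/r) \<odot> h) \<otimes> z) = \<phi> (z \<otimes> ((1/r) \<odot> h))"
      using h r by (intro contr) (auto simp: adj_smult)
    then show ?thesis
      using h r z by (simp add: lin_rules scale)
  qed
  obtain h k where "h \<in> carrier A" "k \<in> carrier A" "adj A h = h" "adj A k = k" "x = h \<oplus> \<i> \<odot> k"
    using selfadjoint_parts[OF x] by metis
  then show ?thesis
    using z sa[of h] sa[of k] by (simp add: lin_rules add scale)
qed

end

subsection \<open>Tracial states\<close>

text \<open>The expression is the squared length of x + c y, with \<open>\<beta>\<close> and
  \<open>\<gamma>\<close> the two mixed inner products. The values c = 1 and c = i give Hermitian
  symmetry. Putting c = -t times the conjugate of \<open>\<beta>\<close> leaves a real quadratic in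
  t, whose positivity at t = 1 / \<open>Re B\<close> is the Cauchy-Schwarz inequality.\<close>

lemma hermitian_quadratic:
  fixes A B \<beta> \<gamma> :: complex
  assumes q: "\<And>c. A + c * \<beta> + cnj c * \<gamma> + c * cnj c * B \<in> \<real>\<^sub>\<ge>\<^sub>0" and B: "B \<in> \<real>\<^sub>\<ge>\<^sub>0"
  shows "\<gamma> = cnj \<beta>" "(cmod \<beta>)\<^sup>2 \<le> Re A * Re B"
proof -
  have A: "Re A \<ge> 0" "Im A = 0"
    using q[of 0] by (auto simp: nonneg_Reals_def complex_nonneg_Reals_iff)
  have B': "Re B \<ge> 0" "Im B = 0"
    using B by (auto simp: complex_nonneg_Reals_iff)
  show \<gamma>: "\<gamma> = cnj \<beta>"
    using q[of 1] q[of \<i>] A B' by (auto simp: complex_nonneg_Reals_iff complex_eq_iff)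
  have *: "Re A - 2 * t * (cmod \<beta>)\<^sup>2 + t\<^sup>2 * (cmod \<beta>)\<^sup>2 * Re B \<ge> 0" for t :: real
  proof -
    have "Re (A + c * \<beta> + cnj c * \<gamma> + c * cnj c * B) \<ge> 0" if "c = - of_real t * cnj \<beta>" for c
      using q[of c] by (simp add: complex_nonneg_Reals_iff)
    then show ?thesis
      unfolding cmod_power2 by (simp add: \<gamma> B' algebra_simps power2_eq_square)
  qed
  show "(cmod \<beta>)\<^sup>2 \<le> Re A * Re B"
  proof (cases "Re B = 0")
    case True
    have "(cmod \<beta>)\<^sup>2 = 0"
    proof (rule ccontr)
      assume "(cmod \<beta>)\<^sup>2 \<noteq> 0"
      \<comment> \<open>For \<open>Re B = 0\<close> the quadratic is affine in t, and this t takes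
        it to \<open>Re A - 2 * (Re A + 1)\<close>, which is negative.\<close>
      then have "2 * ((Re A + 1) / (cmod \<beta>)\<^sup>2) * (cmod \<beta>)\<^sup>2 = 2 * (Re A + 1)"
        by simp
      then show False
        using *[of "(Re A + 1) / (cmod \<beta>)\<^sup>2"] True A by simp
    qed
    then show ?thesis
      using True by simp
  next
    case False
    then show ?thesis
      using *[of "1 / Re B"] B' by (simp add: field_simps power2_eq_square)
  qed
qed

locale traced_algebra = cstar_algebra A for A :: "('a, 'z) cstar_algebra_scheme" (structure) +
  fixes \<tau> :: "'a \<Rightarrow> complex"
  assumes tracial_state: "\<tau> \<in> tracial_states A"
begin

lemma tr_add: "x \<in> carrier A \<Longrightarrow> y \<in> carrier A \<Longrightarrow> \<tau> (x \<oplus> y) = \<tau> x + \<tau> y"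
  and tr_scale: "x \<in> carrier A \<Longrightarrow> \<tau> (c \<odot> x) = c * \<tau> x"
  and tr_nonneg: "x \<in> carrier A \<Longrightarrow> \<tau> (adj A x \<otimes> x) \<in> \<real>\<^sub>\<ge>\<^sub>0"
  and tr_one: "\<tau> \<one> = 1"
  and tr_commute: "x \<in> carrier A \<Longrightarrow> y \<in> carrier A \<Longrightarrow> \<tau> (x \<otimes> y) = \<tau> (y \<otimes> x)"
  using tracial_state by (auto simp: tracial_states_def)

lemma tr_zero [simp]: "\<tau> \<zero> = 0"
  using tr_scale[of \<zero> 0] by simp

lemma tr_diff: "x \<in> carrier A \<Longrightarrow> y \<in> carrier A \<Longrightarrow> \<tau> (x \<ominus> y) = \<tau> x - \<tau> y"
  by (simp add: diff_scale tr_add tr_scale)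

text \<open>The 2-norm of the GNS construction. It is a seminorm in general, since
  \<open>\<tau>\<close> need not be faithful.\<close>

definition tnorm :: "'a \<Rightarrow> real" where
  "tnorm x = sqrt (Re (\<tau> (adj A x \<otimes> x)))"

lemma tnorm_nonneg [simp]: "x \<in> carrier A \<Longrightarrow> 0 \<le> tnorm x"
  using tr_nonneg[of x] by (simp add: tnorm_def complex_nonneg_Reals_iff)

lemma tr_adj_mult_self: "x \<in> carrier A \<Longrightarrow> \<tau> (adj A x \<otimes> x) = complex_of_real ((tnorm x)\<^sup>2)"
  using tr_nonneg[of x] by (simp add: tnorm_def complex_nonneg_Reals_iff complex_eq_iff)

lemma tnorm_sq: "x \<in> carrier A \<Longrightarrow> (tnorm x)\<^sup>2 = Re (\<tau> (adj A x \<otimes> x))"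
  by (simp add: tr_adj_mult_self)

lemma tr_quadratic:
  assumes "x \<in> carrier A" "y \<in> carrier A"
  shows "\<tau> (adj A (x \<oplus> c \<odot> y) \<otimes> (x \<oplus> c \<odot> y)) =
    \<tau> (adj A x \<otimes> x) + c * \<tau> (adj A x \<otimes> y) + cnj c * \<tau> (adj A y \<otimes> x) + c * cnj c * \<tau> (adj A y \<otimes> y)"
  using assms by (simp add: lin_rules tr_add tr_scale algebra_simps)

lemma
  assumes "x \<in> carrier A" "y \<in> carrier A"
  shows tr_hermitian: "\<tau> (adj A y \<otimes> x) = cnj (\<tau> (adj A x \<otimes> y))"
    and Cauchy_Schwarz: "cmod (\<tau> (adj A x \<otimes> y)) \<le> tnorm x * tnorm y"
proof -
  have q: "\<tau> (adj A x \<otimes> x) + c * \<tau> (adj A x \<otimes> y) + cnj c * \<tau> (adj A y \<otimes> x) + c * cnj c * \<tau> (adj A y \<otimes> y)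
    \<in> \<real>\<^sub>\<ge>\<^sub>0" for c
    unfolding tr_quadratic[OF assms, symmetric] using assms by (intro tr_nonneg) auto
  note hq = hermitian_quadratic[of "\<tau> (adj A x \<otimes> x)" "\<tau> (adj A x \<otimes> y)" "\<tau> (adj A y \<otimes> x)" "\<tau> (adj A y \<otimes> y)",
      OF q tr_nonneg[OF assms(2)]]
  show "\<tau> (adj A y \<otimes> x) = cnj (\<tau> (adj A x \<otimes> y))"
    by (rule hq(1))
  have "(cmod (\<tau> (adj A x \<otimes> y)))\<^sup>2 \<le> (tnorm x * tnorm y)\<^sup>2"
    unfolding power_mult_distrib tnorm_sq[OF assms(1)] tnorm_sq[OF assms(2)]
    by (rule hq(2))
  then show "cmod (\<tau> (adj A x \<otimes> y)) \<le> tnorm x * tnorm y"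
    by (rule power2_le_imp_le) (use assms in auto)
qed

lemma tr_adj: "x \<in> carrier A \<Longrightarrow> \<tau> (adj A x) = cnj (\<tau> x)"
  using tr_hermitian[of \<one> x] by (simp add: A_rules(12))

lemma tnorm_one: "tnorm \<one> = 1"
  by (simp add: tnorm_def tr_one)

lemma cmod_tr_le: "x \<in> carrier A \<Longrightarrow> cmod (\<tau> x) \<le> tnorm x"
  using Cauchy_Schwarz[of \<one> x] by (simp add: tnorm_one)

lemma Cauchy_Schwarz_tr: "x \<in> carrier A \<Longrightarrow> y \<in> carrier A \<Longrightarrow> cmod (\<tau> (x \<otimes> y)) \<le> tnorm (adj A x) * tnorm y"
  using Cauchy_Schwarz[of "adj A x" y] by (simp add: adj_adj)

lemma tnorm_adj [simp]: "x \<in> carrier A \<Longrightarrow> tnorm (adj A x) = tnorm x"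
  using tr_commute[of x "adj A x"] by (simp add: tnorm_def adj_adj)

lemma tnorm_scale: "x \<in> carrier A \<Longrightarrow> tnorm (c \<odot> x) = cmod c * tnorm x"
proof -
  assume x: "x \<in> carrier A"
  have "(tnorm (c \<odot> x))\<^sup>2 = (cmod c * tnorm x)\<^sup>2"
    using x complex_norm_square[of c, symmetric]
    by (simp add: tnorm_sq lin_rules tr_scale power_mult_distrib flip: mult.assoc)
  then show ?thesis
    using x by simp
qed

lemma tnorm_triangle:
  assumes "x \<in> carrier A" "y \<in> carrier A"
  shows "tnorm (x \<oplus> y) \<le> tnorm x + tnorm y"
proof -
  have "(tnorm (x \<oplus> y))\<^sup>2 = (tnorm x)\<^sup>2 + 2 * Re (\<tau> (adj A x \<otimes> y)) + (tnorm y)\<^sup>2"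
    using tr_quadratic[OF assms, of 1] tr_hermitian[OF assms] assms by (simp add: tnorm_sq)
  also have "\<dots> \<le> (tnorm x)\<^sup>2 + 2 * (tnorm x * tnorm y) + (tnorm y)\<^sup>2"
    using Cauchy_Schwarz[OF assms] complex_Re_le_cmod[of "\<tau> (adj A x \<otimes> y)"] by simp
  also have "\<dots> = (tnorm x + tnorm y)\<^sup>2"
    by (simp add: power2_sum)
  finally show ?thesis
    by (rule power2_le_imp_le) (use assms in auto)
qed

lemma parallelogram:
  assumes "x \<in> carrier A" "y \<in> carrier A"
  shows "(tnorm (x \<ominus> y))\<^sup>2 = 2 * (tnorm x)\<^sup>2 + 2 * (tnorm y)\<^sup>2 - 4 * (tnorm ((1/2) \<odot> (x \<oplus> y)))\<^sup>2"
proof -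
  have "(tnorm (x \<oplus> y))\<^sup>2 = (tnorm x)\<^sup>2 + 2 * Re (\<tau> (adj A x \<otimes> y)) + (tnorm y)\<^sup>2"
    using tr_quadratic[OF assms, of 1] tr_hermitian[OF assms] assms by (simp add: tnorm_sq)
  moreover have "(tnorm (x \<ominus> y))\<^sup>2 = (tnorm x)\<^sup>2 - 2 * Re (\<tau> (adj A x \<otimes> y)) + (tnorm y)\<^sup>2"
    using tr_quadratic[OF assms, of "-1"] tr_hermitian[OF assms] assms by (simp add: tnorm_sq diff_scale)
  moreover have "4 * (tnorm ((1/2) \<odot> (x \<oplus> y)))\<^sup>2 = (tnorm (x \<oplus> y))\<^sup>2"
    using assms by (simp add: tnorm_scale norm_divide power_divide)
  ultimately show ?thesis
    by simp
qed

lemma tnorm_conj_unitary: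
  assumes "u \<in> unitaries A" "x \<in> carrier A"
  shows "tnorm (u \<otimes> x \<otimes> adj A u) = tnorm x"
proof -
  have u: "u \<in> carrier A"
    using assms unitary_closed by blast
  have "adj A (u \<otimes> x \<otimes> adj A u) \<otimes> (u \<otimes> x \<otimes> adj A u) = u \<otimes> (adj A x \<otimes> (x \<otimes> adj A u))"
    using assms u by (simp add: adj_mult adj_adj A_rules(11) unitary_cancel)
  also have "\<tau> \<dots> = \<tau> ((adj A x \<otimes> (x \<otimes> adj A u)) \<otimes> u)"
    using assms u by (intro tr_commute) auto
  also have "(adj A x \<otimes> (x \<otimes> adj A u)) \<otimes> u = adj A x \<otimes> x"
    using assms u by (simp add: A_rules(11)) (simp add: unitaries_def)
  finally show ?thesis
    by (simp add: tnorm_def)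
qed

text \<open>With \<open>c\<close> a self-adjoint square root of \<open>\<one> \<ominus> a\<close>,
  moving one factor \<open>c\<close> around the trace turns the expression into the trace of
  \<open>adj A (z \<otimes> c) \<otimes> (z \<otimes> c)\<close>.\<close>

lemma tr_one_minus_nonneg:
  assumes a: "a \<in> carrier A" "adj A a = a" "cnorm A a < 1" and z: "z \<in> carrier A"
  shows "\<tau> (adj A z \<otimes> z \<otimes> (\<one> \<ominus> a)) \<in> \<real>\<^sub>\<ge>\<^sub>0"
proof -
  obtain c where c: "c \<in> carrier A" "adj A c = c" "c \<otimes> c = \<one> \<ominus> a"
    using exists_sqrt_one_minus[OF a] by metis
  have "\<tau> (adj A z \<otimes> z \<otimes> (\<one> \<ominus> a)) = \<tau> ((adj A z \<otimes> z \<otimes> c) \<otimes> c)"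
    using c z by (simp flip: c(3) add: A_rules(11))
  also have "\<dots> = \<tau> (c \<otimes> (adj A z \<otimes> z \<otimes> c))"
    using c z by (intro tr_commute) auto
  also have "c \<otimes> (adj A z \<otimes> z \<otimes> c) = adj A (z \<otimes> c) \<otimes> (z \<otimes> c)"
    using c z by (simp add: adj_mult A_rules(11))
  finally show ?thesis
    using c z by (simp add: tr_nonneg)
qed

text \<open>For \<open>r > cnorm A x\<close> the element \<open>x \<otimes> adj A x\<close> divided
  by the square of \<open>r\<close> is a strict contraction, so the preceding positivity applies and
  gives the bound with \<open>r\<close>. Letting \<open>r\<close> decrease to
  \<open>cnorm A x\<close> finishes the proof.\<close>

lemma tnorm_mult_right:
  assumes x: "x \<in> carrier A" and z: "z \<in> carrier A"
  shows "tnorm (z \<otimes> x) \<le> cnorm A x * tnorm z"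
proof -
  have *: "tnorm (z \<otimes> x) \<le> r * tnorm z" if r: "r > cnorm A x" for r
  proof -
    have r0: "r > 0"
      using r cnorm_nonneg[OF x] by linarith
    define c where "c = complex_of_real (1 / r\<^sup>2)"
    let ?a = "c \<odot> (x \<otimes> adj A x)"
    have "cnorm A (x \<otimes> adj A x) = (cnorm A x)\<^sup>2"
      using cstar_identity[of "adj A x"] x by (simp add: adj_adj)
    moreover have "(cnorm A x)\<^sup>2 < r\<^sup>2"
      using r x by (intro power_strict_mono) auto
    ultimately have "cnorm A ?a < 1"
      using x r0 by (simp add: c_def cnorm_smult norm_divide norm_power)
    then have "\<tau> (adj A z \<otimes> z \<otimes> (\<one> \<ominus> ?a)) \<in> \<real>\<^sub>\<ge>\<^sub>0"
      using x z by (intro tr_one_minus_nonneg) (auto simp: c_def lin_rules)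
    moreover have "\<tau> (adj A z \<otimes> z \<otimes> (\<one> \<ominus> ?a)) = \<tau> (adj A z \<otimes> z) - c * \<tau> ((adj A z \<otimes> z \<otimes> x) \<otimes> adj A x)"
      using x z by (simp add: lin_rules tr_add tr_scale)
    moreover have "\<tau> ((adj A z \<otimes> z \<otimes> x) \<otimes> adj A x) = \<tau> (adj A x \<otimes> (adj A z \<otimes> z \<otimes> x))"
      using x z by (intro tr_commute) auto
    moreover have "adj A x \<otimes> (adj A z \<otimes> z \<otimes> x) = adj A (z \<otimes> x) \<otimes> (z \<otimes> x)"
      using x z by (simp add: adj_mult A_rules(11))
    ultimately have "complex_of_real ((tnorm z)\<^sup>2 - (1 / r\<^sup>2) * (tnorm (z \<otimes> x))\<^sup>2) \<in> \<real>\<^sub>\<ge>\<^sub>0"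
      using x z by (simp add: tr_adj_mult_self c_def)
    then have "(tnorm z)\<^sup>2 - (1 / r\<^sup>2) * (tnorm (z \<otimes> x))\<^sup>2 \<ge> 0"
      by (simp only: nonneg_Reals_of_real_iff)
    then have "(tnorm (z \<otimes> x))\<^sup>2 \<le> (r * tnorm z)\<^sup>2"
      using r0 by (simp add: field_simps power_mult_distrib)
    then show ?thesis
      by (rule power2_le_imp_le) (use r0 z in auto)
  qed
  show ?thesis
  proof (cases "tnorm z = 0")
    case True
    then show ?thesis
      using *[of "cnorm A x + 1"] by simp
  next
    case False
    then have z0: "tnorm z > 0"
      using tnorm_nonneg[OF z] by linarith
    have "tnorm (z \<otimes> x) / tnorm z \<le> cnorm A x"
      by (rule dense_ge) (use * z0 in \<open>simp add: divide_le_eq\<close>)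
    then show ?thesis
      using z0 by (simp add: divide_le_eq)
  qed
qed

lemma tnorm_mult_left:
  assumes x: "x \<in> carrier A" and z: "z \<in> carrier A"
  shows "tnorm (x \<otimes> z) \<le> cnorm A x * tnorm z"
  using tnorm_mult_right[of "adj A x" "adj A z"] tnorm_adj[of "x \<otimes> z"] x z
  by (simp add: adj_mult)

text \<open>Positivity of the functional sending \<open>x\<close> to
  \<open>\<tau> (x \<otimes> w)\<close>. Required of \<open>\<one> \<oplus> y\<close> and
  \<open>\<one> \<ominus> y\<close>, it is a weak form of saying that \<open>y\<close> lies between
  -1 and 1, and it is stable under conjugation and midpoints.\<close>

definition pos_weight :: "'a \<Rightarrow> bool" where
  "pos_weight w \<longleftrightarrow> w \<in> carrier A \<and> (\<forall>z\<in>carrier A. \<tau> (adj A z \<otimes> z \<otimes> w) \<in> \<real>\<^sub>\<ge>\<^sub>0)"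

text \<open>Cyclicity of the trace turns conjugation of one factor by \<open>v\<close> into
  conjugation of the other by \<open>adj A v\<close>.\<close>

lemma tr_conj_shift:
  assumes "v \<in> carrier A" "w \<in> carrier A" "x \<in> carrier A"
  shows "\<tau> (x \<otimes> (v \<otimes> w \<otimes> adj A v)) = \<tau> (adj A v \<otimes> x \<otimes> v \<otimes> w)"
  using assms tr_commute[of "x \<otimes> v \<otimes> w" "adj A v"] by (simp add: A_rules(11))

lemma pos_weight_conj:
  assumes w: "pos_weight w" and v: "v \<in> carrier A"
  shows "pos_weight (v \<otimes> w \<otimes> adj A v)"
proof -
  have "\<tau> (adj A z \<otimes> z \<otimes> (v \<otimes> w \<otimes> adj A v)) \<in> \<real>\<^sub>\<ge>\<^sub>0" if z: "z \<in> carrier A" for z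
  proof -
    have wA: "w \<in> carrier A"
      using w by (simp add: pos_weight_def)
    have "\<tau> (adj A z \<otimes> z \<otimes> (v \<otimes> w \<otimes> adj A v)) = \<tau> (adj A v \<otimes> (adj A z \<otimes> z) \<otimes> v \<otimes> w)"
      using v wA z by (intro tr_conj_shift) auto
    also have "adj A v \<otimes> (adj A z \<otimes> z) \<otimes> v = adj A (z \<otimes> v) \<otimes> (z \<otimes> v)"
      using v z by (simp add: adj_mult A_rules(11))
    finally show ?thesis
      using w v z by (simp add: pos_weight_def)
  qed
  then show ?thesis
    using w v by (simp add: pos_weight_def)
qed

lemma pos_weight_midpoint:
  assumes "pos_weight v" "pos_weight w"
  shows "pos_weight ((1/2) \<odot> (v \<oplus> w))"
proof -
  have A: "v \<in> carrier A" "w \<in> carrier A"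
    using assms by (auto simp: pos_weight_def)
  have "\<tau> (adj A z \<otimes> z \<otimes> ((1/2) \<odot> (v \<oplus> w))) \<in> \<real>\<^sub>\<ge>\<^sub>0" if z: "z \<in> carrier A" for z
  proof -
    have "\<tau> (adj A z \<otimes> z \<otimes> ((1/2) \<odot> (v \<oplus> w))) =
        (1/2) * (\<tau> (adj A z \<otimes> z \<otimes> v) + \<tau> (adj A z \<otimes> z \<otimes> w))"
      using A z by (simp add: smult_mult_right A_rules(23) scale_distrib tr_add tr_scale)
    also have "\<dots> \<in> \<real>\<^sub>\<ge>\<^sub>0"
      using assms z unfolding pos_weight_def
      by (intro nonneg_Reals_mult_I nonneg_Reals_add_I) (auto simp: complex_nonneg_Reals_iff)
    finally show ?thesis .
  qed
  then show ?thesis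
    using A by (simp add: pos_weight_def)
qed

lemma pos_weight_one_minus:
  assumes "a \<in> carrier A" "adj A a = a" "cnorm A a < 1"
  shows "pos_weight (\<one> \<ominus> a)"
  using assms tr_one_minus_nonneg[OF assms] by (simp add: pos_weight_def)

end

section \<open>Extreme traces and the commutator estimate\<close>

text \<open>Extremality in midpoint form. The equality for \<open>\<psi>\<close> follows from the
  one for \<open>\<phi>\<close> by averaging.\<close>

locale extreme_trace = traced_algebra +
  assumes extreme: "\<lbrakk>\<phi> \<in> tracial_states A; \<psi> \<in> tracial_states A;
    \<And>x. x \<in> carrier A \<Longrightarrow> \<tau> x = (\<phi> x + \<psi> x) / 2; x \<in> carrier A\<rbrakk> \<Longrightarrow> \<phi> x = \<tau> x"
begin

text \<open>
  A set of functionals dominated by the trace that is invariant under unitary conjugation contains,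
  in its weak closure, a tracial one: approximate minimisers of the 2-norm form a Cauchy sequence
  that is asymptotically fixed by conjugation. Extremality forces the limit functional to vanish.
\<close>

lemma weakly_null_sequence:
  assumes C: "C \<subseteq> carrier A" "C \<noteq> {}"
    and conj: "\<And>u y. u \<in> unitaries A \<Longrightarrow> y \<in> C \<Longrightarrow> u \<otimes> y \<otimes> adj A u \<in> C"
    and mid: "\<And>x y. x \<in> C \<Longrightarrow> y \<in> C \<Longrightarrow> (1/2) \<odot> (x \<oplus> y) \<in> C"
    and zero: "\<And>y. y \<in> C \<Longrightarrow> \<tau> y = 0"
    and pos: "\<And>y. y \<in> C \<Longrightarrow> pos_weight (\<one> \<oplus> y)" "\<And>y. y \<in> C \<Longrightarrow> pos_weight (\<one> \<ominus> y)"
  obtains y where "\<And>n::nat. y n \<in> C" "\<And>x. x \<in> carrier A \<Longrightarrow> (\<lambda>n. \<tau> (x \<otimes> y n)) \<longlonglongrightarrow> 0"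
proof -
  define m where "m = (INF y\<in>C. tnorm y)"
  have bdd: "bdd_below (tnorm ` C)"
    using C by (intro bdd_belowI2[of _ 0]) auto
  have m_le: "m \<le> tnorm y" if "y \<in> C" for y
    unfolding m_def using bdd that by (rule cINF_lower)
  have m0: "m \<ge> 0"
    unfolding m_def using C by (intro cINF_greatest) auto
  have "\<exists>y\<in>C. tnorm y < m + 1 / real (Suc n)" for n
    using cINF_less_iff[OF C(2) bdd, of "m + 1 / real (Suc n)"] by (simp add: m_def)
  then obtain y where y: "\<And>n. y n \<in> C" "\<And>n. tnorm (y n) < m + 1 / real (Suc n)"
    by metis
  have yA [simp]: "y n \<in> carrier A" for n
    using y C by blast
  \<comment> \<open>By the parallelogram identity \<open>g n + g k\<close> bounds the squared
    distance of two approximate minimisers, because their midpoint lies in \<open>C\<close> and so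
    has 2-norm at least \<open>m\<close>.\<close>
  define g where "g n = 2 * (m + 1 / real (Suc n))\<^sup>2 - 2 * m\<^sup>2" for n
  have "(\<lambda>n. 2 * (m + 1 / real (Suc n))\<^sup>2 - 2 * m\<^sup>2) \<longlonglongrightarrow> 2 * (m + 0)\<^sup>2 - 2 * m\<^sup>2"
    by (intro tendsto_intros LIMSEQ_inverse_real_of_nat[unfolded inverse_eq_divide])
  then have g_lim: "g \<longlonglongrightarrow> 0"
    by (simp add: g_def[abs_def])
  have close: "(tnorm (v \<ominus> w))\<^sup>2 \<le> g n + g k"
    if "v \<in> C" "w \<in> C" "tnorm v < m + 1 / real (Suc n)" "tnorm w < m + 1 / real (Suc k)" for v w n k
  proof -
    have "(tnorm v)\<^sup>2 \<le> (m + 1 / real (Suc n))\<^sup>2" "(tnorm w)\<^sup>2 \<le> (m + 1 / real (Suc k))\<^sup>2"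
      using that C by (auto intro!: power_mono)
    moreover have "m\<^sup>2 \<le> (tnorm ((1/2) \<odot> (v \<oplus> w)))\<^sup>2"
      using m_le[OF mid] that m0 by (intro power_mono) auto
    ultimately show ?thesis
      using parallelogram[of v w] that C unfolding g_def by (simp add: subset_iff)
  qed
  have Cauchy_y: "Cauchy (\<lambda>n. \<tau> (x \<otimes> y n))" if x: "x \<in> carrier A" for x
  proof (rule metric_CauchyI)
    fix e :: real assume e: "e > 0"
    \<comment> \<open>Two values of \<open>g\<close> are added in \<open>close\<close>, hence the
      division by 2; the added 1 avoids dividing by a vanishing 2-norm of \<open>x\<close>.\<close>
    define d where "d = (e / (tnorm x + 1))\<^sup>2 / 2"
    have x1: "tnorm x + 1 > 0"
      using tnorm_nonneg[OF x] by linarith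
    then have "d > 0"
      using e by (simp add: d_def)
    then obtain N where N: "g n < d" if "n \<ge> N" for n
      using order_tendstoD(2)[OF g_lim] by (auto simp: eventually_sequentially)
    show "\<exists>N. \<forall>j\<ge>N. \<forall>n\<ge>N. dist (\<tau> (x \<otimes> y j)) (\<tau> (x \<otimes> y n)) < e"
    proof (intro exI allI impI)
      fix j n assume jn: "N \<le> j" "N \<le> n"
      have "(tnorm (y j \<ominus> y n))\<^sup>2 \<le> g j + g n"
        by (rule close[OF y(1) y(1) y(2) y(2)])
      then have "(tnorm (y j \<ominus> y n))\<^sup>2 < (e / (tnorm x + 1))\<^sup>2"
        using N[OF jn(1)] N[OF jn(2)] by (simp add: d_def)
      then have *: "tnorm (y j \<ominus> y n) < e / (tnorm x + 1)"
        by (rule power2_less_imp_less) (use e x1 in simp)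
      have "dist (\<tau> (x \<otimes> y j)) (\<tau> (x \<otimes> y n)) = cmod (\<tau> (x \<otimes> (y j \<ominus> y n)))"
        using x by (simp add: dist_norm lin_rules tr_add tr_scale)
      also have "\<dots> \<le> tnorm x * tnorm (y j \<ominus> y n)"
        using Cauchy_Schwarz_tr[of x "y j \<ominus> y n"] x by simp
      also have "\<dots> \<le> (tnorm x + 1) * tnorm (y j \<ominus> y n)"
        by (intro mult_right_mono) auto
      also have "\<dots> < e"
        using * x1 by (simp add: less_divide_eq mult.commute)
      finally show "dist (\<tau> (x \<otimes> y j)) (\<tau> (x \<otimes> y n)) < e" .
    qed
  qed
  define L where "L x = lim (\<lambda>n. \<tau> (x \<otimes> y n))" for x
  have L: "(\<lambda>n. \<tau> (x \<otimes> y n)) \<longlonglongrightarrow> L x" if "x \<in> carrier A" for x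
    using Cauchy_y[OF that] by (simp add: L_def Cauchy_convergent_iff convergent_LIMSEQ_iff)
  have L_add: "L (x \<oplus> z) = L x + L z" if "x \<in> carrier A" "z \<in> carrier A" for x z
  proof (rule LIMSEQ_unique)
    show "(\<lambda>n. \<tau> ((x \<oplus> z) \<otimes> y n)) \<longlonglongrightarrow> L x + L z"
      using tendsto_add[OF L[OF that(1)] L[OF that(2)]] that by (simp add: A_rules(13) tr_add)
  qed (use L that in auto)
  have L_scale: "L (c \<odot> x) = c * L x" if "x \<in> carrier A" for c x
  proof (rule LIMSEQ_unique)
    show "(\<lambda>n. \<tau> ((c \<odot> x) \<otimes> y n)) \<longlonglongrightarrow> c * L x"
      using tendsto_mult_left[OF L[OF that], of c] that by (simp add: smult_mult_left tr_scale)
  qed (use L that in auto)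
  have L_unitary: "L (u \<otimes> x) = L (x \<otimes> u)" if u: "u \<in> unitaries A" and x: "x \<in> carrier A" for u x
  proof -
    have uA: "u \<in> carrier A"
      using u unitary_closed by blast
    \<comment> \<open>The defect of traciality at stage \<open>n\<close> is a trace against
      \<open>y n\<close> minus its conjugate. The conjugate lies in \<open>C\<close> and has the
      same 2-norm, so it is an approximate minimiser of the same quality and \<open>close\<close>
      applies to the pair.\<close>
    have diff: "\<tau> (u \<otimes> x \<otimes> y n) - \<tau> (x \<otimes> u \<otimes> y n) = \<tau> (u \<otimes> x \<otimes> (y n \<ominus> u \<otimes> y n \<otimes> adj A u))" for n
    proof -
      have "\<tau> (u \<otimes> x \<otimes> (u \<otimes> y n \<otimes> adj A u)) = \<tau> (x \<otimes> u \<otimes> y n)"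
        using tr_conj_shift[of u "y n" "u \<otimes> x"] u uA x by (simp add: A_rules(11) unitary_cancel)
      moreover have "u \<otimes> x \<otimes> (y n \<ominus> w) = u \<otimes> x \<otimes> y n \<ominus> u \<otimes> x \<otimes> w" if "w \<in> carrier A" for w
        using that uA x by (simp add: diff_scale A_rules(23) smult_mult_right)
      ultimately show ?thesis
        using uA x by (simp add: tr_diff)
    qed
    have bound: "cmod (\<tau> (u \<otimes> x \<otimes> y n) - \<tau> (x \<otimes> u \<otimes> y n)) \<le> tnorm (u \<otimes> x) * sqrt (2 * g n)" for n
    proof -
      have "(tnorm (y n \<ominus> u \<otimes> y n \<otimes> adj A u))\<^sup>2 \<le> g n + g n"
        using y(2)[of n] by (intro close y(1) conj u) (simp_all only: tnorm_conj_unitary[OF u yA])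
      then have "tnorm (y n \<ominus> u \<otimes> y n \<otimes> adj A u) \<le> sqrt (2 * g n)"
        by (simp add: real_le_rsqrt)
      moreover have "cmod (\<tau> (u \<otimes> x \<otimes> (y n \<ominus> u \<otimes> y n \<otimes> adj A u)))
          \<le> tnorm (u \<otimes> x) * tnorm (y n \<ominus> u \<otimes> y n \<otimes> adj A u)"
        using Cauchy_Schwarz_tr[of "u \<otimes> x" "y n \<ominus> u \<otimes> y n \<otimes> adj A u"]
          tnorm_adj[of "u \<otimes> x"] uA x by simp
      ultimately show ?thesis
        unfolding diff using mult_left_mono[of _ "sqrt (2 * g n)" "tnorm (u \<otimes> x)"] uA x
        by (meson A_rules(5) order_trans tnorm_nonneg)
    qed
    have lim: "(\<lambda>n. tnorm (u \<otimes> x) * sqrt (2 * g n)) \<longlonglongrightarrow> tnorm (u \<otimes> x) * sqrt (2 * 0)"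
      by (intro tendsto_intros g_lim)
    have "(\<lambda>n. \<tau> (u \<otimes> x \<otimes> y n) - \<tau> (x \<otimes> u \<otimes> y n)) \<longlonglongrightarrow> 0"
      using bound by (intro Lim_null_comparison[OF _ lim[simplified]]) auto
    moreover have "(\<lambda>n. \<tau> (u \<otimes> x \<otimes> y n) - \<tau> (x \<otimes> u \<otimes> y n)) \<longlonglongrightarrow> L (u \<otimes> x) - L (x \<otimes> u)"
      using uA x by (intro tendsto_diff L) auto
    ultimately show ?thesis
      using LIMSEQ_unique by fastforce
  qed
  have L_commute: "L (x \<otimes> z) = L (z \<otimes> x)" if "x \<in> carrier A" "z \<in> carrier A" for x z
    by (rule tracial_if_unitary_invariant[of L]) (fact L_add L_scale L_unitary that)+
  have L_one: "L \<one> = 0"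
    using L[of \<one>] zero[OF y(1)] by (simp add: A_rules(12) LIMSEQ_const_iff)
  \<comment> \<open>Both \<open>\<tau>\<close> plus \<open>L\<close> and \<open>\<tau>\<close> minus
    \<open>L\<close> are tracial states: positivity passes to the limit from \<open>pos\<close>, and
    \<open>L \<one> = 0\<close> keeps them normalised. Their average is \<open>\<tau>\<close>, so
    extremality gives \<open>L = 0\<close> on the carrier.\<close>
  have state: "(\<lambda>x\<in>carrier A. \<tau> x + s * L x) \<in> tracial_states A" if s: "s = 1 \<or> s = -1" for s
  proof -
    have "\<tau> (adj A z \<otimes> z) + s * L (adj A z \<otimes> z) \<in> \<real>\<^sub>\<ge>\<^sub>0" if z: "z \<in> carrier A" for z
    proof (rule Lim_in_closed_set[OF closed_nonneg_Reals_complex])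
      show "(\<lambda>n. \<tau> (adj A z \<otimes> z) + s * \<tau> (adj A z \<otimes> z \<otimes> y n)) \<longlonglongrightarrow> \<tau> (adj A z \<otimes> z) + s * L (adj A z \<otimes> z)"
        using z by (intro tendsto_intros L) auto
      have "\<tau> (adj A z \<otimes> z) + s * \<tau> (adj A z \<otimes> z \<otimes> y n) \<in> \<real>\<^sub>\<ge>\<^sub>0" for n
      proof -
        have "\<tau> (adj A z \<otimes> z \<otimes> (\<one> \<oplus> y n)) \<in> \<real>\<^sub>\<ge>\<^sub>0" "\<tau> (adj A z \<otimes> z \<otimes> (\<one> \<ominus> y n)) \<in> \<real>\<^sub>\<ge>\<^sub>0"
          using pos[OF y(1)[of n]] z unfolding pos_weight_def by blast+
        moreover have "\<tau> (adj A z \<otimes> z \<otimes> (\<one> \<oplus> y n)) = \<tau> (adj A z \<otimes> z) + \<tau> (adj A z \<otimes> z \<otimes> y n)"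
          "\<tau> (adj A z \<otimes> z \<otimes> (\<one> \<ominus> y n)) = \<tau> (adj A z \<otimes> z) - \<tau> (adj A z \<otimes> z \<otimes> y n)"
          using z by (simp_all add: A_rules(23) diff_scale smult_mult_right tr_add tr_scale)
        ultimately show ?thesis
          using s by (elim disjE) simp_all
      qed
      then show "\<forall>\<^sub>F n in sequentially. \<tau> (adj A z \<otimes> z) + s * \<tau> (adj A z \<otimes> z \<otimes> y n) \<in> \<real>\<^sub>\<ge>\<^sub>0"
        by simp
    qed simp
    then show ?thesis
      using L_one by (auto simp: tracial_states_def tr_add tr_scale tr_one L_add L_scale L_commute
          tr_commute algebra_simps)
  qed
  have "L x = 0" if x: "x \<in> carrier A" for x
    using extreme[OF state[of 1] state[of "-1"] _ x] x by simp
  then show thesis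
    using that[of y] y(1) L by metis
qed

lemma tnorm_le_commutator_selfadjoint:
  assumes a: "a \<in> carrier A" "adj A a = a" "cnorm A a < 1" "\<tau> a = 0"
    and \<delta>: "\<And>u. u \<in> unitaries A \<Longrightarrow> tnorm (u \<otimes> a \<otimes> adj A u \<ominus> a) \<le> \<delta>"
  shows "tnorm a \<le> \<delta>"
proof -
  \<comment> \<open>The lower bound that Cauchy-Schwarz and the hypothesis on
    \<open>\<delta>\<close> give for the trace of any unitary conjugate of \<open>a\<close> times
    \<open>a\<close>.\<close>
  define \<kappa> where "\<kappa> = (tnorm a)\<^sup>2 - \<delta> * tnorm a"
  \<comment> \<open>Instead of the convex hull of the conjugates of \<open>a\<close>, the set of all
    elements with the properties used later. Quantifying the last clause over all unitaries makes it
    invariant under conjugation.\<close>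
  define C where "C = {y \<in> carrier A. \<tau> y = 0 \<and> pos_weight (\<one> \<oplus> y) \<and> pos_weight (\<one> \<ominus> y) \<and>
    (\<forall>u\<in>unitaries A. \<kappa> \<le> Re (\<tau> (u \<otimes> a \<otimes> adj A u \<otimes> y)))}"
  have "\<kappa> \<le> Re (\<tau> (u \<otimes> a \<otimes> adj A u \<otimes> a))" if u: "u \<in> unitaries A" for u
  proof -
    have uA: "u \<in> carrier A"
      using u unitary_closed by blast
    let ?b = "u \<otimes> a \<otimes> adj A u \<ominus> a"
    have "?b \<otimes> a = u \<otimes> a \<otimes> adj A u \<otimes> a \<ominus> a \<otimes> a"
      using uA a(1) by (simp add: diff_scale A_rules(13) smult_mult_left)
    then have "\<tau> (u \<otimes> a \<otimes> adj A u \<otimes> a) = \<tau> (adj A a \<otimes> a) + \<tau> (?b \<otimes> a)"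
      using uA a(1,2) by (simp add: tr_diff)
    then have "Re (\<tau> (u \<otimes> a \<otimes> adj A u \<otimes> a)) = (tnorm a)\<^sup>2 + Re (\<tau> (?b \<otimes> a))"
      using a(1) by (simp add: tnorm_sq)
    moreover have "cmod (\<tau> (?b \<otimes> a)) \<le> tnorm ?b * tnorm a"
      using Cauchy_Schwarz_tr[of ?b a] tnorm_adj[of ?b] uA a(1) by simp
    moreover have "tnorm ?b * tnorm a \<le> \<delta> * tnorm a"
      using \<delta>[OF u] a(1) by (intro mult_right_mono) auto
    moreover have "- cmod (\<tau> (?b \<otimes> a)) \<le> Re (\<tau> (?b \<otimes> a))"
      using abs_Re_le_cmod[of "\<tau> (?b \<otimes> a)"] by linarith
    ultimately show ?thesis
      unfolding \<kappa>_def by linarith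
  qed
  moreover have "pos_weight (\<one> \<oplus> a)"
  proof -
    have "\<one> \<ominus> ((-1) \<odot> a) = \<one> \<oplus> a"
      using a(1) by (simp add: diff_scale scale_scale)
    then show ?thesis
      using pos_weight_one_minus[of "(-1) \<odot> a"] a by (simp add: adj_smult cnorm_smult)
  qed
  ultimately have aC: "a \<in> C"
    using a pos_weight_one_minus[OF a(1-3)] by (simp add: C_def)
  have CA: "C \<subseteq> carrier A"
    by (auto simp: C_def)
  have C_conj: "v \<otimes> y \<otimes> adj A v \<in> C" if v: "v \<in> unitaries A" and y: "y \<in> C" for v y
  proof -
    have A: "v \<in> carrier A" "y \<in> carrier A"
      using v y CA unitary_closed by auto
    have v': "v \<otimes> adj A v = \<one>" "adj A v \<otimes> v = \<one>"
      using v by (auto simp: unitaries_def)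
    have "\<tau> (v \<otimes> y \<otimes> adj A v) = \<tau> y"
      using tr_conj_shift[of v y \<one>] A v' by (simp add: A_rules(12))
    moreover have "v \<otimes> (\<one> \<oplus> y) \<otimes> adj A v = \<one> \<oplus> v \<otimes> y \<otimes> adj A v"
      "v \<otimes> (\<one> \<ominus> y) \<otimes> adj A v = \<one> \<ominus> v \<otimes> y \<otimes> adj A v"
      using A v' by (simp_all add: diff_scale A_rules(13,23) smult_mult_left smult_mult_right)
    moreover have "\<kappa> \<le> Re (\<tau> (u \<otimes> a \<otimes> adj A u \<otimes> (v \<otimes> y \<otimes> adj A v)))" if u: "u \<in> unitaries A" for u
    proof -
      have uA: "u \<in> carrier A"
        using u unitary_closed by blast
      \<comment> \<open>Conjugating \<open>y\<close> by \<open>v\<close> amounts to testing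
        \<open>y\<close> against the conjugate of \<open>a\<close> by
        \<open>adj A v \<otimes> u\<close>.\<close>
      have "adj A v \<otimes> u \<in> unitaries A"
        using u v by (intro mult_unitary adj_unitary)
      then have "\<kappa> \<le> Re (\<tau> ((adj A v \<otimes> u) \<otimes> a \<otimes> adj A (adj A v \<otimes> u) \<otimes> y))"
        using y by (simp add: C_def)
      also have "(adj A v \<otimes> u) \<otimes> a \<otimes> adj A (adj A v \<otimes> u) \<otimes> y = adj A v \<otimes> (u \<otimes> a \<otimes> adj A u) \<otimes> v \<otimes> y"
        using A uA a(1) by (simp add: adj_mult adj_adj A_rules(11))
      also have "\<tau> \<dots> = \<tau> (u \<otimes> a \<otimes> adj A u \<otimes> (v \<otimes> y \<otimes> adj A v))"
        using A uA a(1) by (intro tr_conj_shift[symmetric]) auto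
      finally show ?thesis .
    qed
    ultimately show ?thesis
      using y A pos_weight_conj[of "\<one> \<oplus> y" v] pos_weight_conj[of "\<one> \<ominus> y" v]
      by (simp add: C_def)
  qed
  have C_mid: "(1/2) \<odot> (x \<oplus> y) \<in> C" if xy: "x \<in> C" "y \<in> C" for x y
  proof -
    have A: "x \<in> carrier A" "y \<in> carrier A"
      using xy CA by auto
    have half: "(1/2) \<odot> \<one> \<oplus> (1/2) \<odot> \<one> = \<one>"
      by (simp flip: scale_add)
    have "(1/2) \<odot> ((\<one> \<oplus> x) \<oplus> (\<one> \<oplus> y)) = ((1/2) \<odot> \<one> \<oplus> (1/2) \<odot> \<one>) \<oplus> (1/2) \<odot> (x \<oplus> y)"
      "(1/2) \<odot> ((\<one> \<ominus> x) \<oplus> (\<one> \<ominus> y)) = ((1/2) \<odot> \<one> \<oplus> (1/2) \<odot> \<one>) \<ominus> (1/2) \<odot> (x \<oplus> y)"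
      using A by (simp_all add: lin_rules)
    then have "pos_weight (\<one> \<oplus> (1/2) \<odot> (x \<oplus> y))" "pos_weight (\<one> \<ominus> (1/2) \<odot> (x \<oplus> y))"
      using pos_weight_midpoint[of "\<one> \<oplus> x" "\<one> \<oplus> y"] pos_weight_midpoint[of "\<one> \<ominus> x" "\<one> \<ominus> y"] xy
      unfolding half by (auto simp: C_def)
    moreover have "\<kappa> \<le> Re (\<tau> (u \<otimes> a \<otimes> adj A u \<otimes> ((1/2) \<odot> (x \<oplus> y))))" if u: "u \<in> unitaries A" for u
    proof -
      have "u \<otimes> a \<otimes> adj A u \<in> carrier A"
        using u unitary_closed a(1) by auto
      then have eq: "Re (\<tau> (u \<otimes> a \<otimes> adj A u \<otimes> ((1/2) \<odot> (x \<oplus> y)))) =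
          (Re (\<tau> (u \<otimes> a \<otimes> adj A u \<otimes> x)) + Re (\<tau> (u \<otimes> a \<otimes> adj A u \<otimes> y))) / 2"
        using A by (simp add: A_rules(23) scale_distrib smult_mult_right tr_add tr_scale)
      have "\<kappa> \<le> Re (\<tau> (u \<otimes> a \<otimes> adj A u \<otimes> x))" "\<kappa> \<le> Re (\<tau> (u \<otimes> a \<otimes> adj A u \<otimes> y))"
        using xy u unfolding C_def by blast+
      then show ?thesis
        unfolding eq by (simp add: field_simps)
    qed
    ultimately show ?thesis
      using A xy by (simp add: C_def tr_add tr_scale)
  qed
  have "C \<noteq> {}"
    using aC by blast
  then obtain y where y: "\<And>n::nat. y n \<in> C"
    and null: "\<And>x. x \<in> carrier A \<Longrightarrow> (\<lambda>n. \<tau> (x \<otimes> y n)) \<longlonglongrightarrow> 0"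
    using weakly_null_sequence[OF CA _ C_conj C_mid] unfolding C_def by blast
  \<comment> \<open>The last clause of \<open>C\<close> for the unitary \<open>\<one>\<close>. Along
    the weakly null sequence it forces \<open>\<kappa> \<le> 0\<close>.\<close>
  have "\<kappa> \<le> Re (\<tau> (a \<otimes> y n))" for n
    using y[of n] one_unitary a(1) unfolding C_def by (force simp: A_rules(12))
  then have "\<kappa> \<le> 0"
    using LIMSEQ_le_const[OF tendsto_Re[OF null[OF a(1)]]] by auto
  then have "tnorm a * tnorm a \<le> \<delta> * tnorm a"
    by (simp add: \<kappa>_def power2_eq_square)
  \<comment> \<open>Settles the case \<open>tnorm a = 0\<close>, in which the common factor cannot
    be cancelled.\<close>
  moreover have "0 \<le> \<delta>"
    using \<delta>[OF one_unitary] tnorm_nonneg[of "\<one> \<otimes> a \<otimes> adj A \<one> \<ominus> a"] a(1) by (meson A_rules(4,5,6) adj_closed order_trans)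
  ultimately show ?thesis
    using a(1) tnorm_nonneg[of a] by (metis mult_right_le_imp_le order_le_less)
qed

text \<open>The real and imaginary parts of \<open>a\<close> have trace 0 and inherit the bound
  \<open>\<delta>\<close>, because the adjoint preserves the 2-norm of
  \<open>u \<otimes> a \<otimes> adj A u \<ominus> a\<close>. Adding the two self-adjoint estimates
  gives the factor 2.\<close>

lemma tnorm_le_commutator:
  assumes a: "a \<in> carrier A" "\<tau> a = 0"
    and \<delta>: "\<And>u. u \<in> unitaries A \<Longrightarrow> tnorm (u \<otimes> a \<otimes> adj A u \<ominus> a) \<le> \<delta>"
  shows "tnorm a \<le> 2 * \<delta>"
proof -
  have sa: "tnorm h \<le> \<delta>" if h: "h \<in> carrier A" "adj A h = h" "\<tau> h = 0"
    and h\<delta>: "\<And>u. u \<in> unitaries A \<Longrightarrow> tnorm (u \<otimes> h \<otimes> adj A u \<ominus> h) \<le> \<delta>" for h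
  proof -
    \<comment> \<open>Rescaling by \<open>r\<close> yields a strict contraction; the estimate is
      homogeneous, so \<open>r\<close> cancels in the end.\<close>
    define r where "r = cnorm A h + 1"
    have r: "r > 0"
      unfolding r_def using cnorm_nonneg[OF h(1)] by linarith
    have "tnorm (complex_of_real (1/r) \<odot> h) \<le> \<delta> / r"
    proof (rule tnorm_le_commutator_selfadjoint)
      show "cnorm A (complex_of_real (1/r) \<odot> h) < 1"
        using h(1) r by (simp add: cnorm_smult norm_divide) (simp add: r_def)
      fix u assume u: "u \<in> unitaries A"
      have "u \<otimes> (complex_of_real (1/r) \<odot> h) \<otimes> adj A u \<ominus> complex_of_real (1/r) \<odot> h
          = complex_of_real (1/r) \<odot> (u \<otimes> h \<otimes> adj A u \<ominus> h)"
        using unitary_closed[OF u] h(1) by (simp add: diff_scale smult_mult_left smult_mult_right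
            scale_distrib scale_scale)
      then show "tnorm (u \<otimes> (complex_of_real (1/r) \<odot> h) \<otimes> adj A u \<ominus> complex_of_real (1/r) \<odot> h) \<le> \<delta> / r"
        using h\<delta>[OF u] unitary_closed[OF u] h(1) r by (simp add: tnorm_scale norm_divide divide_right_mono)
    qed (use h in \<open>simp_all add: adj_smult tr_scale\<close>)
    then show ?thesis
      using h(1) r by (simp add: tnorm_scale norm_divide divide_le_cancel)
  qed
  have \<delta>_adj: "tnorm (u \<otimes> adj A a \<otimes> adj A u \<ominus> adj A a) \<le> \<delta>" if u: "u \<in> unitaries A" for u
  proof -
    have "u \<otimes> adj A a \<otimes> adj A u \<ominus> adj A a = adj A (u \<otimes> a \<otimes> adj A u \<ominus> a)"
      using unitary_closed[OF u] a(1) by (simp add: adj_diff adj_mult adj_adj A_rules(11))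
    then show ?thesis
      using \<delta>[OF u] unitary_closed[OF u] a(1) by simp
  qed
  \<comment> \<open>Both real and imaginary part have the form \<open>h = c (a + s a\<^sup>*)\<close> with \<open>|c| = 1/2\<close> and \<open>|s| = 1\<close>.\<close>
  have part: "tnorm (u \<otimes> h \<otimes> adj A u \<ominus> h) \<le> \<delta>"
    if u: "u \<in> unitaries A" and h: "h = c \<odot> (a \<oplus> s \<odot> adj A a)" and cs: "cmod c = 1/2" "cmod s = 1" for u h c s
  proof -
    have uA: "u \<in> carrier A"
      using u unitary_closed by blast
    let ?x = "u \<otimes> a \<otimes> adj A u \<ominus> a" and ?y = "u \<otimes> adj A a \<otimes> adj A u \<ominus> adj A a"
    have "u \<otimes> h \<otimes> adj A u \<ominus> h = c \<odot> (?x \<oplus> s \<odot> ?y)"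
      unfolding h using uA a(1) by (simp add: lin_rules mult.commute)
    then have "tnorm (u \<otimes> h \<otimes> adj A u \<ominus> h) = tnorm (?x \<oplus> s \<odot> ?y) / 2"
      using uA a(1) cs by (simp add: tnorm_scale)
    moreover have "tnorm (?x \<oplus> s \<odot> ?y) \<le> tnorm ?x + tnorm (s \<odot> ?y)"
      using uA a(1) by (intro tnorm_triangle) auto
    moreover have "tnorm (s \<odot> ?y) = tnorm ?y"
      using uA a(1) cs by (simp add: tnorm_scale)
    ultimately show ?thesis
      using \<delta>[OF u] \<delta>_adj[OF u] by linarith
  qed
  obtain h k where hk: "h \<in> carrier A" "k \<in> carrier A" "adj A h = h" "adj A k = k"
    "a = h \<oplus> \<i> \<odot> k" and h: "h = (1/2) \<odot> (a \<oplus> adj A a)" and k: "k = (-\<i>/2) \<odot> (a \<ominus> adj A a)"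
    by (rule selfadjoint_parts[OF a(1)]) (rule that)
  have h': "h = (1/2) \<odot> (a \<oplus> 1 \<odot> adj A a)" and k': "k = (-\<i>/2) \<odot> (a \<oplus> (-1) \<odot> adj A a)"
    using h k a(1) by (simp_all add: diff_scale)
  have "tnorm h \<le> \<delta>"
    by (rule sa[OF hk(1,3) _ part[OF _ h']]) (use a in \<open>simp_all add: h tr_add tr_scale tr_adj\<close>)
  moreover have "tnorm k \<le> \<delta>"
    by (rule sa[OF hk(2,4) _ part[OF _ k']])
       (use a in \<open>simp_all add: k tr_diff tr_scale tr_adj norm_divide\<close>)
  moreover have "tnorm a \<le> tnorm h + tnorm k"
    using tnorm_triangle[of h "\<i> \<odot> k"] hk(1,2) unfolding hk(5)[symmetric] by (simp add: tnorm_scale)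
  ultimately show ?thesis
    by simp
qed

end

subsection \<open>Traces at the points of the base\<close>

lemma cfun_algebra_simps [simp]:
  "f \<in> carrier (cfun_algebra K) \<longleftrightarrow> f \<in> extensional (topspace K) \<and> continuous_map K euclidean f"
  "mult (cfun_algebra K) f g = (\<lambda>x\<in>topspace K. f x * g x)"
  "one (cfun_algebra K) = (\<lambda>x\<in>topspace K. 1)"
  "zero (cfun_algebra K) = (\<lambda>x\<in>topspace K. 0)"
  "add (cfun_algebra K) f g = (\<lambda>x\<in>topspace K. f x + g x)"
  "smult (cfun_algebra K) c f = (\<lambda>x\<in>topspace K. c * f x)"
  "adj (cfun_algebra K) f = (\<lambda>x\<in>topspace K. cnj (f x))"
  by (simp_all add: cfun_algebra_def)

lemma cfun_bdd_above:
  assumes "compact_space K" "continuous_map K euclidean (f :: 'k \<Rightarrow> complex)"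
  shows "bdd_above ((\<lambda>x. cmod (f x)) ` topspace K)"
proof -
  have "compact (f ` topspace K)"
    using image_compactin[of K "topspace K" euclidean f] assms by (simp add: compact_space_def)
  then have "bounded (f ` topspace K)"
    by (rule compact_imp_bounded)
  then show ?thesis
    by (auto simp: bounded_iff bdd_above_def)
qed

text \<open>The conjunct \<open>0 \<le> r\<close> comes from the 0 inserted into the supremum and
  carries the whole content when \<open>K\<close> is empty.\<close>

lemma cfun_cnorm_le_iff:
  assumes "compact_space K" "continuous_map K euclidean f"
  shows "cnorm (cfun_algebra K) f \<le> r \<longleftrightarrow> 0 \<le> r \<and> (\<forall>x\<in>topspace K. cmod (f x) \<le> r)"
  using cfun_bdd_above[OF assms] by (simp add: cfun_algebra_def cSup_le_iff)

lemma cfun_cmod_le_cnorm: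
  assumes "compact_space K" "continuous_map K euclidean f" "x \<in> topspace K"
  shows "cmod (f x) \<le> cnorm (cfun_algebra K) f"
  using cfun_cnorm_le_iff[OF assms(1,2)] assms(3) by blast

text \<open>Regularity of a point mass rests on points being closed in a Hausdorff space. If
  \<open>x\<close> lies in \<open>B\<close>, the compact set \<open>{x}\<close> and the open set
  \<open>topspace K\<close> attain both extrema; otherwise the empty set and the complement of
  \<open>{x}\<close> do.\<close>

lemma return_Prob:
  assumes K: "Hausdorff_space K" and x: "x \<in> topspace K"
  shows "return (sigma (topspace K) {V. openin K V}) x \<in> Prob K"
proof -
  let ?S = "sigma (topspace K) {V. openin K V}"
  let ?\<mu> = "return ?S x"
  have sub: "{V. openin K V} \<subseteq> Pow (topspace K)"
    by (auto dest: openin_subset)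
  have sets: "sets ?S = sigma_sets (topspace K) {V. openin K V}"
    using sub by (simp add: sets_measure_of)
  have space: "space ?S = topspace K"
    using sub by (simp add: space_measure_of)
  have opens: "V \<in> sets ?S" if "openin K V" for V
    using that unfolding sets by (simp add: sigma_sets.Basic)
  have "emeasure ?\<mu> B = (INF V\<in>{V. openin K V \<and> B \<subseteq> V}. emeasure ?\<mu> V) \<and>
        emeasure ?\<mu> B = (SUP C\<in>{C. compactin K C \<and> C \<subseteq> B}. emeasure ?\<mu> C)" if B: "B \<in> sets ?S" for B
  proof (cases "x \<in> B")
    case True
    have "closedin K {x}"
      using K x by (simp add: closedin_Hausdorff_sing_eq)
    then have "{x} \<in> sets ?S"
      using opens[of "topspace K - {x}"] sets.compl_sets[of "topspace K - {x}" ?S] x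
      by (simp add: space openin_diff double_diff)
    then have "emeasure ?\<mu> {x} = 1"
      by simp
    then have "emeasure ?\<mu> B \<le> (SUP C\<in>{C. compactin K C \<and> C \<subseteq> B}. emeasure ?\<mu> C)"
      using True x B by (intro SUP_upper2[of "{x}"]) auto
    moreover have "emeasure ?\<mu> V = 1" if "openin K V" "B \<subseteq> V" for V
      using opens[OF that(1)] that(2) True by auto
    moreover have "B \<subseteq> topspace K"
      using sets.sets_into_space[OF B] by (simp add: space)
    moreover have "emeasure ?\<mu> C \<le> 1" if "C \<subseteq> B" for C
      using emeasure_mono[OF that, of ?\<mu>] True B by simp
    ultimately show ?thesis
      using True B by (intro conjI antisym INF_greatest SUP_least INF_lower2[of "topspace K"]) auto
  next
    case False
    have BK: "B \<subseteq> topspace K"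
      using sets.sets_into_space[OF B] by (simp add: space)
    have "closedin K {x}"
      using K x by (simp add: closedin_Hausdorff_sing_eq)
    then have V: "openin K (topspace K - {x})"
      by (simp add: openin_diff)
    then have "emeasure ?\<mu> (topspace K - {x}) = 0"
      using opens by simp
    moreover have "emeasure ?\<mu> B = 0"
      using B False by simp
    moreover have "emeasure ?\<mu> C \<le> emeasure ?\<mu> B" if "C \<subseteq> B" for C
      using that B by (intro emeasure_mono) auto
    ultimately show ?thesis
      using BK False V by (intro conjI antisym INF_greatest SUP_least INF_lower2[of "topspace K - {x}"])
        (auto intro: SUP_upper2[of "{}"])
  qed
  then show ?thesis
    unfolding Prob_def mem_Collect_eq space_return sets_return space sets[symmetric]
    using prob_space_return[of x ?S] x by (auto simp only: space)
qed

text \<open>Evaluation at \<open>x\<close> after the conditional expectation, cut off outside the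
  carrier because members of \<open>tracial_states\<close> are extensional.\<close>

definition point_trace :: "('a, 'k, 'z) wstar_bundle_scheme \<Rightarrow> 'k \<Rightarrow> 'a \<Rightarrow> complex" where
  "point_trace M x = (\<lambda>a\<in>carrier M. cexp M a x)"

section \<open>The uniform 2-norm through its values at points\<close>

context wstar_bundle
begin

lemma cexp_carrier: "a \<in> carrier M \<Longrightarrow> cexp M a \<in> carrier (cfun_algebra (base M))"
  using cexp_closed by blast

lemma cexp_continuous: "a \<in> carrier M \<Longrightarrow> continuous_map (base M) euclidean (cexp M a)"
  using cexp_carrier by simp

lemma incl_cexp_closed: "a \<in> carrier M \<Longrightarrow> incl M (cexp M a) \<in> carrier M"
  using incl_hom cexp_carrier unfolding cstar_hom_def ring_hom_def by blast

lemma cexp_incl_cexp: "a \<in> carrier M \<Longrightarrow> cexp M (incl M (cexp M a)) = cexp M a"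
  using cexp_carrier by (rule cexp_incl)

lemma traced_algebra_point_trace:
  assumes x: "x \<in> topspace (base M)"
  shows "traced_algebra M (point_trace M x)"
proof unfold_locales
  show "point_trace M x \<in> tracial_states M"
    unfolding tracial_states_def point_trace_def using x
    by (auto simp: cexp_add cexp_smult cexp_unital intro: cexp_positive cexp_tracial[THEN fun_cong])
qed

abbreviation point_norm :: "'k \<Rightarrow> 'a \<Rightarrow> real" where
  "point_norm x \<equiv> traced_algebra.tnorm M (point_trace M x)"

text \<open>\<open>norm2\<close> is the supremum of the 2-norms of the point traces. Phrased as a
  bound by a nonnegative number, this covers an empty base as well, and it transfers pointwise
  inequalities to \<open>norm2\<close>.\<close>

lemma norm2_le_iff:
  assumes a: "a \<in> carrier M" and r: "0 \<le> r"
  shows "norm2 M a \<le> r \<longleftrightarrow> (\<forall>x\<in>topspace (base M). point_norm x a \<le> r)"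
proof -
  have sq: "sqrt t \<le> r \<longleftrightarrow> t \<le> r\<^sup>2" for t
    using r by (metis abs_of_nonneg real_sqrt_abs real_sqrt_le_iff)
  have pt: "point_norm x a \<le> r \<longleftrightarrow> cmod (cexp M (adj M a \<otimes> a) x) \<le> r\<^sup>2"
    if x: "x \<in> topspace (base M)" for x
  proof -
    interpret traced_algebra M "point_trace M x"
      using x by (rule traced_algebra_point_trace)
    have "Re (cexp M (adj M a \<otimes> a) x) = cmod (cexp M (adj M a \<otimes> a) x)"
      using cexp_positive[OF a x] by (simp add: complex_nonneg_Reals_iff cmod_eq_Re)
    moreover have "point_trace M x (adj M a \<otimes> a) = cexp M (adj M a \<otimes> a) x"
      using a by (simp add: point_trace_def)
    ultimately show ?thesis
      unfolding tnorm_def sq by (simp only:)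
  qed
  have "norm2 M a \<le> r \<longleftrightarrow> cnorm (cfun_algebra (base M)) (cexp M (adj M a \<otimes> a)) \<le> r\<^sup>2"
    unfolding norm2_def by (rule sq)
  also have "\<dots> \<longleftrightarrow> (\<forall>x\<in>topspace (base M). point_norm x a \<le> r)"
    using cfun_cnorm_le_iff[OF compact_base cexp_continuous, of "adj M a \<otimes> a" "r\<^sup>2"] pt a by simp
  finally show ?thesis .
qed

end

lemma continuous_map_compose_UNIV:
  assumes "continuous_map X euclidean f" "continuous_on UNIV h"
  shows "continuous_map X euclidean (\<lambda>x. h (f x))"
  using continuous_map_compose[OF assms(1), of euclidean h] assms(2) by (simp add: comp_def)

context wstar_bundle
begin

lemma norm2_nonneg [simp]:
  assumes "a \<in> carrier M"
  shows "0 \<le> norm2 M a"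
proof -
  have "continuous_map (base M) euclidean (cexp M (adj M a \<otimes> a))"
    using assms by (intro cexp_continuous) auto
  from cfun_cnorm_le_iff[OF compact_base this]
  have "0 \<le> cnorm (cfun_algebra (base M)) (cexp M (adj M a \<otimes> a))"
    by blast
  then show ?thesis
    by (simp add: norm2_def)
qed

lemma point_norm_le_norm2:
  assumes "a \<in> carrier M" "x \<in> topspace (base M)"
  shows "point_norm x a \<le> norm2 M a"
  using norm2_le_iff[OF assms(1) norm2_nonneg[OF assms(1)]] assms(2) by simp

lemma norm2_triangle:
  assumes "a \<in> carrier M" "b \<in> carrier M"
  shows "norm2 M (a \<oplus> b) \<le> norm2 M a + norm2 M b"
proof -
  have "point_norm x (a \<oplus> b) \<le> norm2 M a + norm2 M b" if x: "x \<in> topspace (base M)" for x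
    using traced_algebra.tnorm_triangle[OF traced_algebra_point_trace[OF x] assms]
      point_norm_le_norm2[OF assms(1) x] point_norm_le_norm2[OF assms(2) x] by linarith
  then show ?thesis
    using assms by (subst norm2_le_iff) auto
qed

lemma norm2_scale_le:
  assumes "a \<in> carrier M"
  shows "norm2 M (c \<odot> a) \<le> cmod c * norm2 M a"
proof -
  have "point_norm x (c \<odot> a) \<le> cmod c * norm2 M a" if x: "x \<in> topspace (base M)" for x
    using traced_algebra.tnorm_scale[OF traced_algebra_point_trace[OF x] assms]
      point_norm_le_norm2[OF assms x] by (simp add: mult_left_mono)
  then show ?thesis
    using assms by (subst norm2_le_iff) auto
qed

lemma norm2_mult_left:
  assumes "a \<in> carrier M" "b \<in> carrier M"
  shows "norm2 M (a \<otimes> b) \<le> cnorm M a * norm2 M b"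
proof -
  have "point_norm x (a \<otimes> b) \<le> cnorm M a * norm2 M b" if x: "x \<in> topspace (base M)" for x
    using traced_algebra.tnorm_mult_left[OF traced_algebra_point_trace[OF x] assms]
      mult_left_mono[OF point_norm_le_norm2[OF assms(2) x] cnorm_nonneg[OF assms(1)]] by linarith
  then show ?thesis
    using assms by (subst norm2_le_iff) auto
qed

lemma norm2_mult_right:
  assumes "a \<in> carrier M" "b \<in> carrier M"
  shows "norm2 M (b \<otimes> a) \<le> cnorm M a * norm2 M b"
proof -
  have "point_norm x (b \<otimes> a) \<le> cnorm M a * norm2 M b" if x: "x \<in> topspace (base M)" for x
    using traced_algebra.tnorm_mult_right[OF traced_algebra_point_trace[OF x] assms]
      mult_left_mono[OF point_norm_le_norm2[OF assms(2) x] cnorm_nonneg[OF assms(1)]] by linarith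
  then show ?thesis
    using assms by (subst norm2_le_iff) auto
qed

lemma norm2_zero [simp]: "norm2 M \<zero> = 0"
  using norm2_scale_le[of \<zero> 0] by (intro antisym) auto

text \<open>The left difference is the commutator times \<open>adj M u\<close>, whose norm is at
  most 1.\<close>

lemma norm2_conj_unitary_diff:
  assumes u: "u \<in> unitaries M" and a: "a \<in> carrier M"
  shows "norm2 M (u \<otimes> a \<otimes> adj M u \<ominus> a) \<le> norm2 M (u \<otimes> a \<ominus> a \<otimes> u)"
proof -
  have uM: "u \<in> carrier M" "u \<otimes> adj M u = \<one>"
    using u by (auto simp: unitaries_def)
  have "u \<otimes> a \<otimes> adj M u \<ominus> a = (u \<otimes> a \<ominus> a \<otimes> u) \<otimes> adj M u"
    using uM a by (simp add: diff_scale A_rules(11,13) smult_mult_left)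
  then have "norm2 M (u \<otimes> a \<otimes> adj M u \<ominus> a) \<le> cnorm M (adj M u) * norm2 M (u \<otimes> a \<ominus> a \<otimes> u)"
    using norm2_mult_right[of "adj M u" "u \<otimes> a \<ominus> a \<otimes> u"] uM a by simp
  also have "\<dots> \<le> norm2 M (u \<otimes> a \<ominus> a \<otimes> u)"
    using cnorm_unitary[OF u] uM a by (simp add: mult_left_le_one_le)
  finally show ?thesis .
qed

text \<open>Places the point traces in the face of bundle traces. Continuity of
  \<open>cexp M a\<close> supplies the Borel measurability needed to integrate against a point
  mass.\<close>

lemma bundle_trace_return:
  assumes x: "x \<in> topspace (base M)"
  shows "bundle_trace M (return (sigma (topspace (base M)) {V. openin (base M) V}) x) = point_trace M x"
proof -
  let ?S = "sigma (topspace (base M)) {V. openin (base M) V}"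
  have sub: "{V. openin (base M) V} \<subseteq> Pow (topspace (base M))"
    by (auto dest: openin_subset)
  have space: "space ?S = topspace (base M)"
    using sub by (simp add: space_measure_of)
  have "(LINT y|return ?S x. cexp M a y) = cexp M a x" if a: "a \<in> carrier M" for a
  proof (rule integral_return)
    show "cexp M a \<in> borel_measurable ?S"
    proof (rule borel_measurableI)
      fix T :: "complex set" assume "open T"
      then have "openin (base M) {y \<in> topspace (base M). cexp M a y \<in> T}"
        using cexp_continuous[OF a] openin_continuous_map_preimage by fastforce
      moreover have "cexp M a -` T \<inter> space ?S = {y \<in> topspace (base M). cexp M a y \<in> T}"
        by (auto simp: space)
      ultimately show "cexp M a -` T \<inter> space ?S \<in> sets ?S"
        using sub by (simp add: sets_measure_of sigma_sets.Basic)
    qed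
  qed (use x space in simp)
  then show ?thesis
    by (simp add: bundle_trace_def point_trace_def cong: restrict_cong)
qed

lemma cexp_diff_incl_cexp:
  assumes "a \<in> carrier M" "x \<in> topspace (base M)"
  shows "cexp M (a \<ominus> incl M (cexp M a)) x = 0"
  using assms incl_cexp_closed[OF assms(1)]
  by (simp add: diff_scale cexp_add cexp_smult cexp_incl_cexp)

text \<open>Serves to show that the families of expectations are norm bounded, for which any fixed
  constant will do. Being unitary is algebraic and hence preserved by \<open>incl M\<close>;
  treating real and imaginary parts of \<open>f\<close> separately costs the factor 2.\<close>

lemma cnorm_incl_le:
  assumes f: "f \<in> carrier (cfun_algebra (base M))" and R: "R > 0"
    and fR: "\<And>x. x \<in> topspace (base M) \<Longrightarrow> cmod (f x) \<le> R"
  shows "cnorm M (incl M f) \<le> 2 * R"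
proof -
  let ?K = "base M"
  let ?C = "cfun_algebra ?K"
  have hom: "incl M g \<in> carrier M" "incl M (c \<odot>\<^bsub>?C\<^esub> g) = c \<odot> incl M g" "incl M (adj ?C g) = adj M (incl M g)"
    if "g \<in> carrier ?C" for g c
    using incl_hom that unfolding cstar_hom_def ring_hom_def by blast+
  have hom2: "incl M (g \<otimes>\<^bsub>?C\<^esub> h) = incl M g \<otimes> incl M h" "incl M (g \<oplus>\<^bsub>?C\<^esub> h) = incl M g \<oplus> incl M h"
    if "g \<in> carrier ?C" "h \<in> carrier ?C" for g h
    using incl_hom that unfolding cstar_hom_def ring_hom_def by blast+
  have hom1: "incl M \<one>\<^bsub>?C\<^esub> = \<one>"
    using incl_hom unfolding cstar_hom_def ring_hom_def by blast
  \<comment> \<open>A real function \<open>g\<close> with values in \<open>[-1, 1]\<close> is the real part of the unitary \<open>g + \<i> \<surd>(1 - g\<^sup>2)\<close>.\<close>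
  have real_le: "cnorm M (incl M (\<lambda>x\<in>topspace ?K. complex_of_real (g x))) \<le> 1"
    if g: "continuous_map ?K euclideanreal g" "\<And>x. x \<in> topspace ?K \<Longrightarrow> \<bar>g x\<bar> \<le> 1" for g
  proof -
    define u where "u = (\<lambda>x\<in>topspace ?K. Complex (g x) (sqrt (1 - (g x)\<^sup>2)))"
    have "continuous_map ?K euclidean (\<lambda>x. complex_of_real (g x) + \<i> * complex_of_real (sqrt (1 - (g x)\<^sup>2)))"
      by (rule continuous_map_compose_UNIV[OF g(1)]) (intro continuous_intros)
    then have u: "u \<in> carrier ?C"
      unfolding u_def by (simp add: Complex_eq continuous_map_eq)
    have u_adj: "adj ?C u \<in> carrier ?C"
      using u continuous_map_compose_UNIV[of ?K u cnj] by (simp add: continuous_map_eq continuous_on_cnj)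
    have "adj ?C u \<otimes>\<^bsub>?C\<^esub> u = \<one>\<^bsub>?C\<^esub>"
    proof -
      have "cnj (u x) * u x = 1" if x: "x \<in> topspace ?K" for x
      proof -
        have "(g x)\<^sup>2 \<le> 1"
          using g(2)[OF x] by (simp add: abs_square_le_1)
        then show ?thesis
          using x by (simp add: u_def complex_eq_iff power2_eq_square[symmetric])
      qed
      then show ?thesis
        by (auto simp: restrict_def)
    qed
    then have "adj M (incl M u) \<otimes> incl M u = \<one>"
      using hom2(1)[OF u_adj u] hom(3)[OF u] hom1 by metis
    then have u1: "cnorm M (incl M u) \<le> 1"
      using hom(1)[OF u] by (intro cnorm_isometry_le_1)
    have "(\<lambda>x\<in>topspace ?K. complex_of_real (g x)) = (1/2) \<odot>\<^bsub>?C\<^esub> (u \<oplus>\<^bsub>?C\<^esub> adj ?C u)"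
      by (auto simp: restrict_def u_def complex_eq_iff)
    moreover have "u \<oplus>\<^bsub>?C\<^esub> adj ?C u \<in> carrier ?C"
      using u u_adj by (simp add: continuous_map_add continuous_map_eq)
    ultimately have "incl M (\<lambda>x\<in>topspace ?K. complex_of_real (g x)) = (1/2) \<odot> (incl M u \<oplus> adj M (incl M u))"
      using hom(2) hom2(2)[OF u u_adj] hom(3)[OF u] by metis
    moreover have "cnorm M (incl M u \<oplus> adj M (incl M u)) \<le> 2"
      using cnorm_triangle[of "incl M u" "adj M (incl M u)"] hom(1)[OF u] u1 by simp
    ultimately show ?thesis
      using hom(1)[OF u] by (simp add: cnorm_smult norm_divide)
  qed
  define g where "g x = Re (f x) / R" for x
  define h where "h x = Im (f x) / R" for x
  let ?g = "\<lambda>x\<in>topspace ?K. complex_of_real (g x)" and ?h = "\<lambda>x\<in>topspace ?K. complex_of_real (h x)"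
  have fc: "continuous_map ?K euclidean f"
    using f by simp
  have gh: "continuous_map ?K euclideanreal g" "continuous_map ?K euclideanreal h"
    unfolding g_def[abs_def] h_def[abs_def] using R
    by (auto intro!: continuous_map_compose_UNIV[OF fc] continuous_intros)
  have abs_le: "\<bar>g x\<bar> \<le> 1" "\<bar>h x\<bar> \<le> 1" if "x \<in> topspace ?K" for x
    using fR[OF that] abs_Re_le_cmod[of "f x"] abs_Im_le_cmod[of "f x"] R
    by (auto simp: g_def h_def)
  have cont: "continuous_map ?K euclidean (\<lambda>x. c * complex_of_real (k x))"
    if "continuous_map ?K euclideanreal k" for k c
    by (rule continuous_map_compose_UNIV[OF that]) (intro continuous_intros)
  have ghC: "?g \<in> carrier ?C" "?h \<in> carrier ?C"
    using cont[of _ 1] gh by (simp_all add: continuous_map_eq)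
  have ghC': "complex_of_real R \<odot>\<^bsub>?C\<^esub> ?g \<in> carrier ?C" "(\<i> * complex_of_real R) \<odot>\<^bsub>?C\<^esub> ?h \<in> carrier ?C"
    using cont[OF gh(1), of "complex_of_real R"] cont[OF gh(2), of "\<i> * complex_of_real R"]
    by (auto intro: continuous_map_eq)
  have "f = complex_of_real R \<odot>\<^bsub>?C\<^esub> ?g \<oplus>\<^bsub>?C\<^esub> (\<i> * complex_of_real R) \<odot>\<^bsub>?C\<^esub> ?h"
  proof (rule extensionalityI[of _ "topspace ?K"])
    show "f x = (complex_of_real R \<odot>\<^bsub>?C\<^esub> ?g \<oplus>\<^bsub>?C\<^esub> (\<i> * complex_of_real R) \<odot>\<^bsub>?C\<^esub> ?h) x"
      if "x \<in> topspace ?K" for x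
      using that R by (simp add: g_def h_def complex_eq_iff)
  qed (use f in auto)
  then have "incl M f = complex_of_real R \<odot> incl M ?g \<oplus> (\<i> * complex_of_real R) \<odot> incl M ?h"
    using hom2(2)[OF ghC'] hom(2)[OF ghC(1)] hom(2)[OF ghC(2)] by metis
  moreover have "cnorm M (complex_of_real R \<odot> incl M ?g) \<le> R" "cnorm M ((\<i> * complex_of_real R) \<odot> incl M ?h) \<le> R"
    using real_le[OF gh(1) abs_le(1)] real_le[OF gh(2) abs_le(2)] hom(1)[OF ghC(1)] hom(1)[OF ghC(2)] R
    by (auto simp: cnorm_smult norm_mult mult_left_le)
  ultimately show ?thesis
    using cnorm_triangle[of "complex_of_real R \<odot> incl M ?g" "(\<i> * complex_of_real R) \<odot> incl M ?h"]
      hom(1)[OF ghC(1)] hom(1)[OF ghC(2)] by simp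
qed

lemma cnorm_incl_cexp_le:
  assumes a: "a \<in> carrier M"
  shows "cnorm M (incl M (cexp M a)) \<le> 2 * (cnorm M a + 1)"
proof (rule cnorm_incl_le)
  show "cmod (cexp M a x) \<le> cnorm M a + 1" if "x \<in> topspace (base M)" for x
    using cfun_cmod_le_cnorm[OF compact_base cexp_continuous[OF a] that] cexp_contractive[OF a] by linarith
  show "cnorm M a + 1 > 0"
    using cnorm_nonneg[OF a] by linarith
qed (use cexp_carrier[OF a] in blast)

lemma incl_cexp_central: "a \<in> carrier M \<Longrightarrow> incl M (cexp M a) \<in> center M"
  using incl_central cexp_carrier by blast

end

section \<open>Factorial bundles: extremality and distance to the expectation\<close>

context factorial_wstar_bundle
begin

text \<open>If the point trace is the average of \<open>\<phi>\<close> and \<open>\<psi>\<close>,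
  the face property makes \<open>\<phi>\<close> a bundle trace, so \<open>\<phi>\<close> agrees on
  \<open>a\<close> and on the expectation \<open>f\<close> of \<open>a\<close>. The point trace is
  multiplicative on the image of C(K), so the difference \<open>z\<close> of \<open>f\<close> and
  its value at \<open>x\<close> is null for it, hence null for \<open>\<phi>\<close>.\<close>

lemma extreme_trace_point_trace:
  assumes x: "x \<in> topspace (base M)"
  shows "extreme_trace M (point_trace M x)"
proof -
  interpret T: traced_algebra M "point_trace M x"
    using x by (rule traced_algebra_point_trace)
  show ?thesis
  proof unfold_locales
    fix \<phi> \<psi> a
    assume \<phi>: "\<phi> \<in> tracial_states M" and \<psi>: "\<psi> \<in> tracial_states M" and a: "a \<in> carrier M"
      and avg: "\<And>b. b \<in> carrier M \<Longrightarrow> point_trace M x b = (\<phi> b + \<psi> b) / 2"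
    interpret P: traced_algebra M \<phi>
      by unfold_locales (rule \<phi>)
    interpret Q: traced_algebra M \<psi>
      by unfold_locales (rule \<psi>)
    let ?F = "bundle_trace M ` Prob (base M)"
    have face: "\<phi> \<in> ?F" if "convex_comb (carrier M) t \<phi> \<psi> \<in> ?F" "t \<in> {0<..<1}" for t
      using bundle_traces_face \<phi> \<psi> that unfolding is_face_def by blast
    have "convex_comb (carrier M) (1/2) \<phi> \<psi> = point_trace M x"
      using avg by (auto simp: convex_comb_def restrict_def point_trace_def fun_eq_iff add_divide_distrib)
    also have "\<dots> \<in> ?F"
      using bundle_trace_return[OF x] return_Prob[OF Hausdorff_base x] by force
    finally have "\<phi> \<in> ?F"
      by (rule face) simp
    then obtain \<mu> where \<mu>: "\<phi> = bundle_trace M \<mu>"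
      by blast
    \<comment> \<open>Traces in the face only depend on the conditional expectation, so it suffices to compare on \<open>C(K)\<close>.\<close>
    define f where "f = incl M (cexp M a)"
    define c where "c = cexp M a x"
    define z where "z = f \<ominus> c \<odot> \<one>"
    have fM: "f \<in> carrier M"
      unfolding f_def by (rule incl_cexp_closed[OF a])
    have zM: "z \<in> carrier M"
      using fM by (simp add: z_def)
    have "\<phi> a = \<phi> f"
      using a fM by (simp add: \<mu> bundle_trace_def f_def cexp_incl_cexp)
    moreover have "\<phi> z = 0"
    proof -
      \<comment> \<open>The right module property pulls \<open>f\<close> out of the expectation, and
        \<open>f\<close> takes the value \<open>c\<close> at \<open>x\<close>; the two terms
        therefore cancel there.\<close>
      have "adj M z \<otimes> z = adj M z \<otimes> f \<oplus> (- c) \<odot> adj M z"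
        using fM zM unfolding z_def[symmetric]
        by (subst (2) z_def) (simp add: diff_scale A_rules(23) scale_scale smult_mult_right monoid.r_one)
      then have "cexp M (adj M z \<otimes> z) x = cexp M (adj M z \<otimes> f) x - c * cexp M (adj M z) x"
        using fM zM x by (simp add: cexp_add cexp_smult)
      also have "cexp M (adj M z \<otimes> f) x = cexp M (adj M z) x * c"
        using cexp_module_right[OF cexp_carrier[OF a], of "adj M z"] zM x
        by (simp add: f_def c_def)
      finally have "point_trace M x (adj M z \<otimes> z) = 0"
        using zM by (simp add: point_trace_def)
      then have "T.tnorm z = 0"
        by (simp add: T.tnorm_def)
      \<comment> \<open>The sum is twice the point trace. Both summands are nonnegative, so both
        vanish, and Cauchy-Schwarz then gives \<open>\<phi> z = 0\<close>.\<close>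
      then have "\<phi> (adj M z \<otimes> z) + \<psi> (adj M z \<otimes> z) = 0"
        using avg[of "adj M z \<otimes> z"] T.tr_adj_mult_self[OF zM] zM by simp
      then have "(P.tnorm z)\<^sup>2 + (Q.tnorm z)\<^sup>2 = 0"
        using P.tr_adj_mult_self[OF zM] Q.tr_adj_mult_self[OF zM] by (simp flip: of_real_add of_real_power)
      then show ?thesis
        using P.cmod_tr_le[OF zM] by (simp add: sum_power2_eq_zero_iff)
    qed
    moreover have "\<phi> z = \<phi> f - c"
      using fM by (simp add: z_def P.tr_diff P.tr_scale P.tr_one)
    ultimately show "\<phi> a = point_trace M x a"
      using a by (simp add: c_def point_trace_def)
  qed
qed

text \<open>Subtracting the central element \<open>?f\<close> leaves all differences with unitary
  conjugates unchanged and makes every point trace vanish. The estimate for extreme traces then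
  applies at each point with the same \<open>\<delta>\<close>.\<close>

lemma norm2_diff_incl_cexp_le:
  assumes a: "a \<in> carrier M"
    and \<delta>: "\<And>u. u \<in> unitaries M \<Longrightarrow> norm2 M (u \<otimes> a \<otimes> adj M u \<ominus> a) \<le> \<delta>"
  shows "norm2 M (a \<ominus> incl M (cexp M a)) \<le> 2 * \<delta>"
proof -
  let ?f = "incl M (cexp M a)"
  have f: "?f \<in> carrier M"
    by (rule incl_cexp_closed[OF a])
  have central: "y \<otimes> ?f = ?f \<otimes> y" if "y \<in> carrier M" for y
    using incl_cexp_central[OF a] that by (simp add: center_def)
  have conj: "u \<otimes> (a \<ominus> ?f) \<otimes> adj M u \<ominus> (a \<ominus> ?f) = u \<otimes> a \<otimes> adj M u \<ominus> a" if u: "u \<in> unitaries M" for u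
  proof -
    have uM: "u \<in> carrier M" "u \<otimes> adj M u = \<one>"
      using u by (auto simp: unitaries_def)
    have "u \<otimes> ?f \<otimes> adj M u = ?f"
      using uM f by (simp add: central A_rules(11))
    moreover have "(p \<ominus> ?f) \<ominus> (a \<ominus> ?f) = p \<ominus> a" if p: "p \<in> carrier M" for p
    proof -
      have "(p \<ominus> ?f) \<ominus> (a \<ominus> ?f) = p \<ominus> a \<oplus> (?f \<ominus> ?f)"
        using p a f by (simp add: lin_rules)
      also have "?f \<ominus> ?f = \<zero>"
        using f by (simp add: diff_eq_zero_iff)
      finally show ?thesis
        using p a by simp
    qed
    moreover have "u \<otimes> (a \<ominus> ?f) \<otimes> adj M u = u \<otimes> a \<otimes> adj M u \<ominus> u \<otimes> ?f \<otimes> adj M u"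
      using uM(1) a f by (simp add: diff_scale A_rules(13,23) smult_mult_left smult_mult_right)
    ultimately show ?thesis
      using uM a by simp
  qed
  \<comment> \<open>Read off from \<open>u = \<one>\<close>, since the pointwise criterion for
    \<open>norm2\<close> asks for a nonnegative bound.\<close>
  have "0 \<le> \<delta>"
    using \<delta>[OF one_unitary] norm2_nonneg[of "\<one> \<otimes> a \<otimes> adj M \<one> \<ominus> a"] a
    by (meson A_rules(4,5,6) adj_closed order_trans)
  moreover have "point_norm x (a \<ominus> ?f) \<le> 2 * \<delta>" if x: "x \<in> topspace (base M)" for x
  proof -
    interpret extreme_trace M "point_trace M x"
      using x by (rule extreme_trace_point_trace)
    show ?thesis
    proof (rule tnorm_le_commutator)
      show "point_trace M x (a \<ominus> ?f) = 0"
        using cexp_diff_incl_cexp[OF a x] a f by (simp add: point_trace_def)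
      fix u assume u: "u \<in> unitaries M"
      have "point_norm x (u \<otimes> a \<otimes> adj M u \<ominus> a) \<le> norm2 M (u \<otimes> a \<otimes> adj M u \<ominus> a)"
        using unitary_closed[OF u] a x by (intro point_norm_le_norm2) auto
      then show "point_norm x (u \<otimes> (a \<ominus> ?f) \<otimes> adj M u \<ominus> (a \<ominus> ?f)) \<le> \<delta>"
        unfolding conj[OF u] using \<delta>[OF u] by linarith
    qed (use a f in auto)
  qed
  ultimately show ?thesis
    using a f by (subst norm2_le_iff) auto
qed

text \<open>The constant 4 instead of 2 yields an actual unitary although the supremum over
  unitaries may not be attained: if every commutator were below a quarter of \<open>?N\<close>, the
  preceding estimate would give that \<open>?N\<close> is at most half of itself, while
  \<open>?N\<close> is positive.\<close>

lemma exists_unitary_commutator: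
  assumes a: "a \<in> carrier M"
  obtains u where "u \<in> unitaries M"
    "norm2 M (a \<ominus> incl M (cexp M a)) \<le> 4 * norm2 M (u \<otimes> a \<ominus> a \<otimes> u)"
proof (rule ccontr)
  let ?N = "norm2 M (a \<ominus> incl M (cexp M a))"
  note uM = unitary_closed
  assume "\<not> thesis"
  then have less: "4 * norm2 M (u \<otimes> a \<ominus> a \<otimes> u) < ?N" if "u \<in> unitaries M" for u
    using that \<open>\<And>u. _ \<Longrightarrow> _ \<Longrightarrow> thesis\<close> by force
  then have "norm2 M (u \<otimes> a \<otimes> adj M u \<ominus> a) \<le> ?N / 4" if "u \<in> unitaries M" for u
    using norm2_conj_unitary_diff[OF that a] less[OF that] by linarith
  then have "?N \<le> 2 * (?N / 4)"
    by (rule norm2_diff_incl_cexp_le[OF a])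
  moreover have "0 < ?N"
    using less[OF one_unitary] norm2_nonneg[of "\<one> \<otimes> a \<ominus> a \<otimes> \<one>"] a
    by (smt (verit) A_rules(4,5,6))
  ultimately show False
    by linarith
qed

end

subsection \<open>The bounded product and the ultraproduct\<close>

lemma linf_product_simps [simp]:
  "mult (linf_product I M) a b = (\<lambda>i\<in>I. a i \<otimes>\<^bsub>M i\<^esub> b i)"
  "one (linf_product I M) = (\<lambda>i\<in>I. \<one>\<^bsub>M i\<^esub>)"
  "zero (linf_product I M) = (\<lambda>i\<in>I. \<zero>\<^bsub>M i\<^esub>)"
  "add (linf_product I M) a b = (\<lambda>i\<in>I. a i \<oplus>\<^bsub>M i\<^esub> b i)"
  by (simp_all add: linf_product_def)

lemma linf_product_carrier_iff:
  "a \<in> carrier (linf_product I M) \<longleftrightarrow>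
    a \<in> extensional I \<and> (\<forall>i\<in>I. a i \<in> carrier (M i)) \<and> (\<exists>B. \<forall>i\<in>I. cnorm (M i) (a i) \<le> B)"
  by (auto simp: linf_product_def PiE_def Pi_def bdd_above_def)

locale factorial_family =
  fixes I :: "'i set" and \<U> :: "'i filter" and M :: "'i \<Rightarrow> ('a, 'k) wstar_bundle"
  assumes factorial_M: "i \<in> I \<Longrightarrow> factorial_wstar_bundle (M i)"
    and eventually_I: "eventually (\<lambda>i. i \<in> I) \<U>"
begin

abbreviation P where "P \<equiv> linf_product I M"
abbreviation J where "J \<equiv> trace_kernel I \<U> M"

lemma wstar: "i \<in> I \<Longrightarrow> wstar_bundle (M i)"
  using factorial_M by (rule factorial_wstar_bundle.axioms)

lemma cstar: "i \<in> I \<Longrightarrow> cstar_algebra (M i)"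
  using wstar by (rule wstar_bundle.axioms)

lemmas ring_M = cstar_algebra.ring_A[OF cstar]
lemmas M_rules = ring.ring_simprules[OF ring_M]

lemma carrier_P_I:
  assumes "\<And>i. i \<in> I \<Longrightarrow> f i \<in> carrier (M i)" "\<And>i. i \<in> I \<Longrightarrow> cnorm (M i) (f i) \<le> B"
  shows "(\<lambda>i\<in>I. f i) \<in> carrier P"
  using assms by (auto simp: linf_product_carrier_iff)

lemma carrier_P_D: "a \<in> carrier P \<Longrightarrow> i \<in> I \<Longrightarrow> a i \<in> carrier (M i)"
  by (simp add: linf_product_carrier_iff)

lemma carrier_P_bound:
  assumes "a \<in> carrier P"
  obtains B where "B \<ge> 0" "\<And>i. i \<in> I \<Longrightarrow> cnorm (M i) (a i) \<le> B"
proof -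
  obtain B where "\<forall>i\<in>I. cnorm (M i) (a i) \<le> B"
    using assms by (auto simp: linf_product_carrier_iff)
  then show thesis
    using that[of "max B 0"] by (auto simp: le_max_iff_disj)
qed

lemma P_ext:
  assumes "a \<in> carrier P" "b \<in> carrier P" "\<And>i. i \<in> I \<Longrightarrow> a i = b i"
  shows "a = b"
  using assms by (auto simp: linf_product_carrier_iff intro: extensionalityI)

lemma add_closed_P: "a \<in> carrier P \<Longrightarrow> b \<in> carrier P \<Longrightarrow> a \<oplus>\<^bsub>P\<^esub> b \<in> carrier P"
proof -
  assume a: "a \<in> carrier P" and b: "b \<in> carrier P"
  obtain B C where "\<And>i. i \<in> I \<Longrightarrow> cnorm (M i) (a i) \<le> B" "\<And>i. i \<in> I \<Longrightarrow> cnorm (M i) (b i) \<le> C"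
    using carrier_P_bound[OF a] carrier_P_bound[OF b] by metis
  then have "cnorm (M i) (a i \<oplus>\<^bsub>M i\<^esub> b i) \<le> B + C" if "i \<in> I" for i
    using cstar_algebra.cnorm_triangle[OF cstar[OF that], of "a i" "b i"] carrier_P_D a b that
    by (meson add_mono order_trans)
  then show ?thesis
    using carrier_P_D a b by (auto intro!: carrier_P_I M_rules)
qed

lemma mult_closed_P: "a \<in> carrier P \<Longrightarrow> b \<in> carrier P \<Longrightarrow> a \<otimes>\<^bsub>P\<^esub> b \<in> carrier P"
proof -
  assume a: "a \<in> carrier P" and b: "b \<in> carrier P"
  obtain B C where B: "B \<ge> 0" "\<And>i. i \<in> I \<Longrightarrow> cnorm (M i) (a i) \<le> B"
    and C: "C \<ge> 0" "\<And>i. i \<in> I \<Longrightarrow> cnorm (M i) (b i) \<le> C"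
    using carrier_P_bound[OF a] carrier_P_bound[OF b] by metis
  have "cnorm (M i) (a i \<otimes>\<^bsub>M i\<^esub> b i) \<le> B * C" if i: "i \<in> I" for i
  proof -
    have "cnorm (M i) (a i) * cnorm (M i) (b i) \<le> B * C"
      using B C i cstar_algebra.cnorm_nonneg[OF cstar[OF i] carrier_P_D[OF b i]] by (intro mult_mono) auto
    then show ?thesis
      using cstar_algebra.cnorm_mult[OF cstar[OF i] carrier_P_D[OF a i] carrier_P_D[OF b i]] by linarith
  qed
  then show ?thesis
    using carrier_P_D a b by (auto intro!: carrier_P_I M_rules)
qed

lemma one_closed_P: "\<one>\<^bsub>P\<^esub> \<in> carrier P"
proof -
  have "cnorm (M i) \<one>\<^bsub>M i\<^esub> \<le> 1" if "i \<in> I" for i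
    using cstar_algebra.cnorm_unitary[OF cstar[OF that] cstar_algebra.one_unitary[OF cstar[OF that]]] .
  then show ?thesis
    by (auto intro!: carrier_P_I M_rules)
qed

lemma zero_closed_P: "\<zero>\<^bsub>P\<^esub> \<in> carrier P"
  using cstar_algebra.cnorm_zero[OF cstar] by (auto intro!: carrier_P_I[where B = 0] M_rules)

lemma neg_closed_P: "a \<in> carrier P \<Longrightarrow> (\<lambda>i\<in>I. \<ominus>\<^bsub>M i\<^esub> a i) \<in> carrier P"
proof -
  assume a: "a \<in> carrier P"
  obtain B where "\<And>i. i \<in> I \<Longrightarrow> cnorm (M i) (a i) \<le> B"
    using carrier_P_bound[OF a] by metis
  then have "cnorm (M i) (\<ominus>\<^bsub>M i\<^esub> a i) \<le> B" if i: "i \<in> I" for i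
    using cstar_algebra.minus_scale[OF cstar[OF i] carrier_P_D[OF a i]]
      cstar_algebra.cnorm_smult[OF cstar[OF i] carrier_P_D[OF a i], of "-1"] i by simp
  then show ?thesis
    using carrier_P_D[OF a] by (auto intro!: carrier_P_I M_rules)
qed

lemma ring_P: "ring P"
proof (rule ringI)
  show "abelian_group P"
  proof (rule abelian_groupI)
    show "\<exists>y\<in>carrier P. y \<oplus>\<^bsub>P\<^esub> x = \<zero>\<^bsub>P\<^esub>" if x: "x \<in> carrier P" for x
      using neg_closed_P[OF x] carrier_P_D[OF x]
      by (intro bexI[of _ "\<lambda>i\<in>I. \<ominus>\<^bsub>M i\<^esub> x i"]) (auto simp: M_rules intro!: restrict_ext)
    show "x \<oplus>\<^bsub>P\<^esub> y \<oplus>\<^bsub>P\<^esub> z = x \<oplus>\<^bsub>P\<^esub> (y \<oplus>\<^bsub>P\<^esub> z)" if "x \<in> carrier P" "y \<in> carrier P" "z \<in> carrier P" for x y z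
      using that by (auto intro!: restrict_ext M_rules(7) carrier_P_D)
    show "x \<oplus>\<^bsub>P\<^esub> y = y \<oplus>\<^bsub>P\<^esub> x" if "x \<in> carrier P" "y \<in> carrier P" for x y
      using that by (auto intro!: restrict_ext M_rules(10) carrier_P_D)
    show "\<zero>\<^bsub>P\<^esub> \<oplus>\<^bsub>P\<^esub> x = x" if "x \<in> carrier P" for x
      using that by (intro P_ext add_closed_P zero_closed_P) (auto intro!: M_rules(8) carrier_P_D)
  qed (fact add_closed_P zero_closed_P)+
  show "monoid P"
  proof (rule monoidI)
    show "x \<otimes>\<^bsub>P\<^esub> y \<otimes>\<^bsub>P\<^esub> z = x \<otimes>\<^bsub>P\<^esub> (y \<otimes>\<^bsub>P\<^esub> z)" if "x \<in> carrier P" "y \<in> carrier P" "z \<in> carrier P" for x y z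
      using that by (auto intro!: restrict_ext M_rules(11) carrier_P_D)
    show "\<one>\<^bsub>P\<^esub> \<otimes>\<^bsub>P\<^esub> x = x" if "x \<in> carrier P" for x
      using that by (intro P_ext mult_closed_P one_closed_P) (auto intro!: M_rules(12) carrier_P_D)
    show "x \<otimes>\<^bsub>P\<^esub> \<one>\<^bsub>P\<^esub> = x" if "x \<in> carrier P" for x
      using that by (intro P_ext mult_closed_P one_closed_P)
        (auto intro!: monoid.r_one[OF ring.is_monoid[OF ring_M]] carrier_P_D)
  qed (fact mult_closed_P one_closed_P)+
  show "(x \<oplus>\<^bsub>P\<^esub> y) \<otimes>\<^bsub>P\<^esub> z = x \<otimes>\<^bsub>P\<^esub> z \<oplus>\<^bsub>P\<^esub> y \<otimes>\<^bsub>P\<^esub> z"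
    if "x \<in> carrier P" "y \<in> carrier P" "z \<in> carrier P" for x y z
    using that by (auto intro!: restrict_ext M_rules(13) carrier_P_D)
  show "z \<otimes>\<^bsub>P\<^esub> (x \<oplus>\<^bsub>P\<^esub> y) = z \<otimes>\<^bsub>P\<^esub> x \<oplus>\<^bsub>P\<^esub> z \<otimes>\<^bsub>P\<^esub> y"
    if "x \<in> carrier P" "y \<in> carrier P" "z \<in> carrier P" for x y z
    using that by (auto intro!: restrict_ext M_rules(23) carrier_P_D)
qed

lemma neg_P: "a \<in> carrier P \<Longrightarrow> \<ominus>\<^bsub>P\<^esub> a = (\<lambda>i\<in>I. \<ominus>\<^bsub>M i\<^esub> a i)"
proof -
  assume a: "a \<in> carrier P"
  have "(\<lambda>i\<in>I. \<ominus>\<^bsub>M i\<^esub> a i) \<oplus>\<^bsub>P\<^esub> a = \<zero>\<^bsub>P\<^esub>"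
    using carrier_P_D[OF a] by (auto simp: M_rules intro!: restrict_ext)
  then show ?thesis
    using abelian_group.minus_equality[OF ring.is_abelian_group[OF ring_P]] neg_closed_P[OF a] a by blast
qed

lemma diff_P:
  assumes "a \<in> carrier P" "b \<in> carrier P" "i \<in> I"
  shows "(a \<ominus>\<^bsub>P\<^esub> b) i = a i \<ominus>\<^bsub>M i\<^esub> b i"
  using assms by (simp add: a_minus_def neg_P)

lemma kernel_iff:
  "a \<in> J \<longleftrightarrow> a \<in> carrier P \<and> ((\<lambda>i. norm2 (M i) (a i)) \<longlongrightarrow> 0) \<U>"
  by (simp add: trace_kernel_def)

text \<open>Domination on \<open>I\<close> suffices, since \<open>\<U>\<close> is concentrated
  there.\<close>

lemma kernelI:
  assumes a: "a \<in> carrier P" and le: "\<And>i. i \<in> I \<Longrightarrow> norm2 (M i) (a i) \<le> g i" and g: "(g \<longlongrightarrow> 0) \<U>"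
  shows "a \<in> J"
proof -
  have "eventually (\<lambda>i. norm (norm2 (M i) (a i)) \<le> g i) \<U>"
    using eventually_I
    by (rule eventually_mono) (use le wstar_bundle.norm2_nonneg[OF wstar carrier_P_D[OF a]] in simp)
  from Lim_null_comparison[OF this g] show ?thesis
    using a by (simp add: kernel_iff)
qed

text \<open>Absorption holds because multiplying by a norm-bounded family, on either side, enlarges
  the 2-norms by at most a common factor.\<close>

lemma ideal_J: "ideal J P"
proof (rule idealI[OF ring_P])
  have neg: "\<ominus>\<^bsub>P\<^esub> a \<in> J" if a: "a \<in> J" for a
  proof (rule kernelI)
    have aP: "a \<in> carrier P"
      using a by (simp add: kernel_iff)
    then show "\<ominus>\<^bsub>P\<^esub> a \<in> carrier P"
      by (rule ring.ring_simprules(3)[OF ring_P])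
    show "norm2 (M i) ((\<ominus>\<^bsub>P\<^esub> a) i) \<le> norm2 (M i) (a i)" if i: "i \<in> I" for i
      using wstar_bundle.norm2_scale_le[OF wstar[OF i] carrier_P_D[OF aP i], of "-1"]
        cstar_algebra.minus_scale[OF cstar[OF i] carrier_P_D[OF aP i]] i by (simp add: neg_P[OF aP])
    show "((\<lambda>i. norm2 (M i) (a i)) \<longlongrightarrow> 0) \<U>"
      using a by (simp add: kernel_iff)
  qed
  have add: "a \<oplus>\<^bsub>P\<^esub> b \<in> J" if a: "a \<in> J" and b: "b \<in> J" for a b
  proof (rule kernelI)
    have abP: "a \<in> carrier P" "b \<in> carrier P"
      using a b by (simp_all add: kernel_iff)
    then show "a \<oplus>\<^bsub>P\<^esub> b \<in> carrier P"
      by (rule add_closed_P)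
    show "norm2 (M i) ((a \<oplus>\<^bsub>P\<^esub> b) i) \<le> norm2 (M i) (a i) + norm2 (M i) (b i)" if i: "i \<in> I" for i
      using wstar_bundle.norm2_triangle[OF wstar[OF i] carrier_P_D[OF abP(1) i] carrier_P_D[OF abP(2) i]] i
      by simp
    show "((\<lambda>i. norm2 (M i) (a i) + norm2 (M i) (b i)) \<longlongrightarrow> 0) \<U>"
      using a b tendsto_add[of "\<lambda>i. norm2 (M i) (a i)" 0 \<U> "\<lambda>i. norm2 (M i) (b i)" 0] by (simp add: kernel_iff)
  qed
  have zero: "\<zero>\<^bsub>P\<^esub> \<in> J"
    using wstar_bundle.norm2_zero[OF wstar] zero_closed_P by (intro kernelI[of _ "\<lambda>_. 0"]) auto
  show "subgroup J (add_monoid P)"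
  proof (rule group.subgroupI[OF abelian_group.a_group[OF ring.is_abelian_group[OF ring_P]]])
    show "J \<subseteq> carrier (add_monoid P)"
      by (auto simp: trace_kernel_def)
    show "J \<noteq> {}"
      using zero by blast
    show "inv\<^bsub>add_monoid P\<^esub> a \<in> J" if "a \<in> J" for a
      using neg[OF that] by (simp add: a_inv_def)
    show "a \<otimes>\<^bsub>add_monoid P\<^esub> b \<in> J" if "a \<in> J" "b \<in> J" for a b
      using add[OF that] by simp
  qed
next
  fix a x assume a: "a \<in> J" and x: "x \<in> carrier P"
  have aP: "a \<in> carrier P"
    using a by (simp add: kernel_iff)
  obtain B where B: "\<And>i. i \<in> I \<Longrightarrow> cnorm (M i) (x i) \<le> B"
    using carrier_P_bound[OF x] by metis
  have lim: "((\<lambda>i. B * norm2 (M i) (a i)) \<longlongrightarrow> 0) \<U>"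
    using a tendsto_mult_left[of "\<lambda>i. norm2 (M i) (a i)" 0 \<U> B] by (simp add: kernel_iff)
  have *: "cnorm (M i) (x i) * norm2 (M i) (a i) \<le> B * norm2 (M i) (a i)" if i: "i \<in> I" for i
    using B[OF i] wstar_bundle.norm2_nonneg[OF wstar[OF i] carrier_P_D[OF aP i]] by (rule mult_right_mono)
  show "x \<otimes>\<^bsub>P\<^esub> a \<in> J"
  proof (rule kernelI[OF _ _ lim])
    show "norm2 (M i) ((x \<otimes>\<^bsub>P\<^esub> a) i) \<le> B * norm2 (M i) (a i)" if i: "i \<in> I" for i
      using wstar_bundle.norm2_mult_left[OF wstar[OF i] carrier_P_D[OF x i] carrier_P_D[OF aP i]] *[OF i] i by simp
  qed (use mult_closed_P x aP in blast)
  show "a \<otimes>\<^bsub>P\<^esub> x \<in> J"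
  proof (rule kernelI[OF _ _ lim])
    show "norm2 (M i) ((a \<otimes>\<^bsub>P\<^esub> x) i) \<le> B * norm2 (M i) (a i)" if i: "i \<in> I" for i
      using wstar_bundle.norm2_mult_right[OF wstar[OF i] carrier_P_D[OF x i] carrier_P_D[OF aP i]] *[OF i] i by simp
  qed (use mult_closed_P x aP in blast)
qed

section \<open>The quotient and its center\<close>

lemma coset_eq_iff: "a \<in> carrier P \<Longrightarrow> b \<in> carrier P \<Longrightarrow> J +>\<^bsub>P\<^esub> a = J +>\<^bsub>P\<^esub> b \<longleftrightarrow> a \<ominus>\<^bsub>P\<^esub> b \<in> J"
  using ring.quotient_eq_iff_same_a_r_cos[OF ring_P ideal_J] by blast

lemma carrier_ultraproduct:
  "carrier (tracial_ultraproduct I \<U> M) = {J +>\<^bsub>P\<^esub> a | a. a \<in> carrier P}"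
  by (auto simp: tracial_ultraproduct_def cstar_quotient_def FactRing_def A_RCOSETS_def')

lemma mult_ultraproduct:
  "a \<in> carrier P \<Longrightarrow> b \<in> carrier P \<Longrightarrow>
    (J +>\<^bsub>P\<^esub> a) \<otimes>\<^bsub>tracial_ultraproduct I \<U> M\<^esub> (J +>\<^bsub>P\<^esub> b) = J +>\<^bsub>P\<^esub> (a \<otimes>\<^bsub>P\<^esub> b)"
  using ideal.rcoset_mult_add[OF ideal_J]
  by (simp add: tracial_ultraproduct_def cstar_quotient_def FactRing_def del: linf_product_simps)

lemma center_ultraproduct_subset:
  "center_ultraproduct I \<U> M \<subseteq> center (tracial_ultraproduct I \<U> M)"
proof
  fix X assume "X \<in> center_ultraproduct I \<U> M"
  then obtain a where a: "a \<in> carrier P" "\<And>i. i \<in> I \<Longrightarrow> a i \<in> center (M i)" and X: "X = J +>\<^bsub>P\<^esub> a"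
    by (auto simp: center_ultraproduct_def)
  have "a \<otimes>\<^bsub>P\<^esub> b = b \<otimes>\<^bsub>P\<^esub> a" if "b \<in> carrier P" for b
    using a(2) carrier_P_D[OF that] by (auto simp: center_def intro!: restrict_ext)
  then show "X \<in> center (tracial_ultraproduct I \<U> M)"
    using a(1) X mult_ultraproduct unfolding center_def carrier_ultraproduct by auto
qed

text \<open>A worst-case unitary is chosen in each coordinate, so that commuting with this single
  family controls the distance from \<open>a\<close> to the family of its expectations, which is a
  central representative.\<close>

lemma center_subset:
  "center (tracial_ultraproduct I \<U> M) \<subseteq> center_ultraproduct I \<U> M"
proof
  fix X assume X: "X \<in> center (tracial_ultraproduct I \<U> M)"
  then obtain a where a: "a \<in> carrier P" and Xa: "X = J +>\<^bsub>P\<^esub> a"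
    by (auto simp: center_def carrier_ultraproduct)
  let ?e = "\<lambda>i. incl (M i) (cexp (M i) (a i))"
  have "\<exists>u. u \<in> unitaries (M i) \<and>
      norm2 (M i) (a i \<ominus>\<^bsub>M i\<^esub> ?e i) \<le> 4 * norm2 (M i) (u \<otimes>\<^bsub>M i\<^esub> a i \<ominus>\<^bsub>M i\<^esub> a i \<otimes>\<^bsub>M i\<^esub> u)" if "i \<in> I" for i
    using factorial_wstar_bundle.exists_unitary_commutator[OF factorial_M[OF that] carrier_P_D[OF a that]] by metis
  then obtain u where u: "\<And>i. i \<in> I \<Longrightarrow> u i \<in> unitaries (M i)"
    and le: "\<And>i. i \<in> I \<Longrightarrow> norm2 (M i) (a i \<ominus>\<^bsub>M i\<^esub> ?e i)
        \<le> 4 * norm2 (M i) (u i \<otimes>\<^bsub>M i\<^esub> a i \<ominus>\<^bsub>M i\<^esub> a i \<otimes>\<^bsub>M i\<^esub> u i)"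
    by metis
  let ?u = "\<lambda>i\<in>I. u i" and ?c = "\<lambda>i\<in>I. ?e i"
  have uP: "?u \<in> carrier P"
    using cstar_algebra.unitary_closed[OF cstar u] cstar_algebra.cnorm_unitary[OF cstar u] by (rule carrier_P_I)
  have cP: "?c \<in> carrier P"
  proof -
    obtain B where B: "\<And>i. i \<in> I \<Longrightarrow> cnorm (M i) (a i) \<le> B"
      using carrier_P_bound[OF a] by metis
    show ?thesis
    proof (rule carrier_P_I)
      show "cnorm (M i) (?e i) \<le> 2 * (B + 1)" if i: "i \<in> I" for i
        by (rule order_trans[OF wstar_bundle.cnorm_incl_cexp_le[OF wstar[OF i] carrier_P_D[OF a i]]])
          (use B[OF i] in simp)
    qed (use wstar_bundle.incl_cexp_closed[OF wstar carrier_P_D[OF a]] in blast)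
  qed
  \<comment> \<open>Centrality of \<open>X\<close>, tested on the coset of \<open>?u\<close>, makes
    the 2-norms of the coordinatewise commutators tend to 0 along \<open>\<U>\<close>; by the choice
    of \<open>?u\<close>, four times these dominate the distances to the expectations.\<close>
  have "J +>\<^bsub>P\<^esub> (?u \<otimes>\<^bsub>P\<^esub> a) = J +>\<^bsub>P\<^esub> (a \<otimes>\<^bsub>P\<^esub> ?u)"
  proof -
    have "J +>\<^bsub>P\<^esub> ?u \<in> carrier (tracial_ultraproduct I \<U> M)"
      using uP unfolding carrier_ultraproduct by blast
    then have "X \<otimes>\<^bsub>tracial_ultraproduct I \<U> M\<^esub> (J +>\<^bsub>P\<^esub> ?u)
        = (J +>\<^bsub>P\<^esub> ?u) \<otimes>\<^bsub>tracial_ultraproduct I \<U> M\<^esub> X"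
      using X by (simp add: center_def)
    then show ?thesis
      unfolding Xa mult_ultraproduct[OF a uP] mult_ultraproduct[OF uP a] by (rule sym)
  qed
  then have "?u \<otimes>\<^bsub>P\<^esub> a \<ominus>\<^bsub>P\<^esub> a \<otimes>\<^bsub>P\<^esub> ?u \<in> J"
    using coset_eq_iff mult_closed_P uP a by blast
  then have lim: "((\<lambda>i. 4 * norm2 (M i) ((?u \<otimes>\<^bsub>P\<^esub> a \<ominus>\<^bsub>P\<^esub> a \<otimes>\<^bsub>P\<^esub> ?u) i)) \<longlongrightarrow> 0) \<U>"
    unfolding kernel_iff using tendsto_mult_left[of _ 0 \<U> "4 :: real"] by fastforce
  have "a \<ominus>\<^bsub>P\<^esub> ?c \<in> J"
  proof (rule kernelI[OF _ _ lim])
    show "a \<ominus>\<^bsub>P\<^esub> ?c \<in> carrier P"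
      using a cP by (rule ring.ring_simprules(4)[OF ring_P])
    show "norm2 (M i) ((a \<ominus>\<^bsub>P\<^esub> ?c) i) \<le> 4 * norm2 (M i) ((?u \<otimes>\<^bsub>P\<^esub> a \<ominus>\<^bsub>P\<^esub> a \<otimes>\<^bsub>P\<^esub> ?u) i)" if i: "i \<in> I" for i
      unfolding diff_P[OF a cP i] diff_P[OF mult_closed_P[OF uP a] mult_closed_P[OF a uP] i]
      using le[OF i] i by simp
  qed
  then have "X = J +>\<^bsub>P\<^esub> ?c"
    using coset_eq_iff a cP Xa by blast
  moreover have "\<forall>i\<in>I. ?c i \<in> center (M i)"
    using wstar_bundle.incl_cexp_central[OF wstar carrier_P_D[OF a]] by simp
  ultimately show "X \<in> center_ultraproduct I \<U> M"
    using cP unfolding center_ultraproduct_def by blast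
qed

end

theorem theorem5p6:
  fixes I :: "'i set" and \<U> :: "'i filter" and M :: "'i \<Rightarrow> ('a, 'k) wstar_bundle"
  assumes "infinite I"
    and "free_ultrafilter_on I \<U>"
    and "\<And>i. i \<in> I \<Longrightarrow> factorial_wstar_bundle (M i)"
  shows "center (tracial_ultraproduct I \<U> M) = center_ultraproduct I \<U> M"
proof -
  interpret factorial_family I \<U> M
    by (rule factorial_family.intro) (use assms in \<open>auto simp: free_ultrafilter_on_def\<close>)
  show ?thesis
    using center_subset center_ultraproduct_subset by (rule antisym)
qed

end
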